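(* Let $M=\mathbb{P}(\mathcal{O}\oplus\mathcal{L})\to\Sigma$ be the admissible manifold over a compact Riemann surface $\Sigma$ of genus $g(\Sigma)>1$. Then there exists a conical extremal metric in any admissible K\"ahler class; that is, for every $x\in(0,1)$ there is $\kappa>0$ such that $\Omega(x,\kappa)$ contains a conical admissible extremal metric with angle $2\pi\kappa$.
   Context: $\Sigma$ is a compact Riemann surface with constant curvature K\"ahler metric $(g_\Sigma,\omega_\Sigma)$, and $\mathcal{L}$ is a holomorphic line bundle over $\Sigma$ with $c_1(\mathcal{L})=\frac1{2\pi}[\omega_\Sigma]$; $M=\mathbb{P}(\mathcal{O}\oplus\mathcal{L})\to\Sigma$. Let $z:M\to[-1,1]$ be the Morse--Bott function with critical set $z^{-1}(\{-1,1\})$ (the zero and infinity sections) such that $M^0=z^{-1}((-1,1))$ is a principal $\mathbb{C}^*$-bundle over $\Sigma$. The admissible metrics are the K\"ahler metrics $$g=\frac{1+xz}{x}g_\Sigma+\frac{dz^2}{\Theta(z)}+\Theta(z)\theta^2,\qquad \omega_g=\frac{1+xz}{x}\omega_\Sigma+dz\wedge\theta,\qquad x\in(0,1),$$ where $\theta$ is a connection $1$-form with $\theta(K)=1$, $d\theta=\omega_\Sigma$, and $K=J\nabla_gz$ generates the $S^1$-action. For $\kappa>0$ let $\mathcal{A}(\kappa)=\{\Theta\in C^\infty[-1,1]: \Theta>0 \text{ on }(-1,1),\ \Theta(\pm1)=0,\ \Theta'(\pm1)=\mp2\kappa\}$. The metric $g$ with $\Theta\in\mathcal{A}(\kappa)$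 is called a conical admissible metric with angle $2\pi\kappa$. After fibre-preserving diffeomorphisms all such metrics with fixed $x,\kappa$ are regarded as lying in one class, denoted $\Omega(x,\kappa)$. An admissible metric is extremal if and only if its scalar curvature is an affine linear function of $z$. The "admissible K\"ahler class corresponding to $x$" leaves the cone angle $2\pi\kappa$ free. *)

theory Defs
  imports "HOL-Analysis.Analysis" "HOL-Homology.Homology"
begin

subsection \<open>Calculus\<close>

definition dir_deriv :: "'a::real_normed_vector \<Rightarrow> ('a \<Rightarrow> real) \<Rightarrow> 'a \<Rightarrow> real" where
  "dir_deriv v f x = deriv (\<lambda>t. f (x + t *\<^sub>R v)) 0"

primrec Ck_on :: "nat \<Rightarrow> ('a::euclidean_space \<Rightarrow> 'b::real_normed_vector) \<Rightarrow> 'a set \<Rightarrow> bool" where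
  "Ck_on 0 f D = continuous_on D f"
| "Ck_on (Suc k) f D =
     (f differentiable_on D \<and> (\<forall>b\<in>Basis. Ck_on k (\<lambda>x. frechet_derivative f (at x) b) D))"

text \<open>Only used for open sets \<open>D\<close>.\<close>
definition smooth_on :: "('a::euclidean_space \<Rightarrow> 'b::real_normed_vector) \<Rightarrow> 'a set \<Rightarrow> bool" where
  "smooth_on f D \<longleftrightarrow> (\<forall>k. Ck_on k f D)"

text \<open>Smoothness up to the end points, with one-sided derivatives there.\<close>
definition smooth_on_Icc :: "(real \<Rightarrow> real) \<Rightarrow> real \<Rightarrow> real \<Rightarrow> bool" where
  "smooth_on_Icc f a b \<longleftrightarrow>
     (\<exists>D :: nat \<Rightarrow> real \<Rightarrow> real. D 0 = f \<and>
        (\<forall>n. \<forall>s\<in>{a..b}. (D n has_real_derivative D (Suc n) s) (at s within {a..b})))"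

subsection \<open>Riemannian and Kaehler geometry in a coordinate chart\<close>

text \<open>A metric is given by its matrix-valued coordinate expression \<open>G\<close>, a 2-form by its matrix
  \<open>W\<close> with \<open>W $ i $ j = \<omega>(\<partial>\<^sub>i, \<partial>\<^sub>j)\<close>, an endomorphism of the tangent bundle by the matrix \<open>J\<close>
  with \<open>J \<partial>\<^sub>j = (\<Sum>i. J $ i $ j \<partial>\<^sub>i)\<close>. In \<open>christoffel G k i j\<close> the index \<open>k\<close> is the upper one.\<close>

definition partial :: "'n::finite \<Rightarrow> (real^'n \<Rightarrow> real) \<Rightarrow> real^'n \<Rightarrow> real" where
  "partial i f y = dir_deriv (axis i 1) f y"

definition christoffel ::
  "(real^'n \<Rightarrow> real^'n^'n) \<Rightarrow> 'n::finite \<Rightarrow> 'n \<Rightarrow> 'n \<Rightarrow> real^'n \<Rightarrow> real" where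
  "christoffel G k i j y = (\<Sum>l\<in>UNIV. matrix_inv (G y) $ k $ l *
     (partial i (\<lambda>p. G p $ j $ l) y + partial j (\<lambda>p. G p $ i $ l) y
        - partial l (\<lambda>p. G p $ i $ j) y)) / 2"

definition ricci ::
  "(real^'n \<Rightarrow> real^'n^'n) \<Rightarrow> 'n::finite \<Rightarrow> 'n \<Rightarrow> real^'n \<Rightarrow> real" where
  "ricci G i j y =
     (\<Sum>k\<in>UNIV. partial k (christoffel G k i j) y - partial j (christoffel G k i k) y) +
     (\<Sum>k\<in>UNIV. \<Sum>l\<in>UNIV. christoffel G k k l y * christoffel G l i j y
        - christoffel G k j l y * christoffel G l i k y)"

definition scalar_curvature :: "(real^'n \<Rightarrow> real^'n^'n) \<Rightarrow> real^'n::finite \<Rightarrow> real" where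
  "scalar_curvature G y = (\<Sum>i\<in>UNIV. \<Sum>j\<in>UNIV. matrix_inv (G y) $ i $ j * ricci G i j y)"

definition gradient ::
  "(real^'n \<Rightarrow> real^'n^'n) \<Rightarrow> (real^'n \<Rightarrow> real) \<Rightarrow> real^'n::finite \<Rightarrow> real^'n" where
  "gradient G f y = matrix_inv (G y) *v (\<chi> i. partial i f y)"

text \<open>The almost complex structure determined by \<open>\<omega>(X, Y) = g(J X, Y)\<close>.\<close>
definition complex_structure ::
  "(real^'n \<Rightarrow> real^'n^'n) \<Rightarrow> (real^'n \<Rightarrow> real^'n^'n) \<Rightarrow> real^'n::finite \<Rightarrow> real^'n^'n" where
  "complex_structure G W y = matrix_inv (G y) ** transpose (W y)"

definition nijenhuis ::
  "(real^'n \<Rightarrow> real^'n^'n) \<Rightarrow> 'n::finite \<Rightarrow> 'n \<Rightarrow> 'n \<Rightarrow> real^'n \<Rightarrow> real" where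
  "nijenhuis J k i j y = (\<Sum>l\<in>UNIV.
       J y $ l $ i * partial l (\<lambda>p. J p $ k $ j) y
     - J y $ l $ j * partial l (\<lambda>p. J p $ k $ i) y
     - J y $ k $ l * (partial i (\<lambda>p. J p $ l $ j) y - partial j (\<lambda>p. J p $ l $ i) y))"

definition kaehler_at ::
  "(real^'n \<Rightarrow> real^'n^'n) \<Rightarrow> (real^'n \<Rightarrow> real^'n^'n) \<Rightarrow> real^'n::finite \<Rightarrow> bool" where
  "kaehler_at G W y \<longleftrightarrow>
     transpose (G y) = G y \<and> (\<forall>v. v \<noteq> 0 \<longrightarrow> v \<bullet> (G y *v v) > 0) \<and>
     transpose (W y) = - W y \<and>
     complex_structure G W y ** complex_structure G W y = - mat 1 \<and>
     (\<forall>i j k. partial i (\<lambda>p. W p $ j $ k) y + partial j (\<lambda>p. W p $ k $ i) y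
        + partial k (\<lambda>p. W p $ i $ j) y = 0) \<and>
     (\<forall>i j k. nijenhuis (complex_structure G W) k i j y = 0)"

text \<open>The \<open>(i, j)\<close> component of the Lie derivative of \<open>J\<close> along \<open>X\<close>.\<close>
definition lie_deriv_endo ::
  "(real^'n \<Rightarrow> real^'n) \<Rightarrow> (real^'n \<Rightarrow> real^'n^'n) \<Rightarrow> 'n::finite \<Rightarrow> 'n \<Rightarrow> real^'n \<Rightarrow> real" where
  "lie_deriv_endo X J i j y = (\<Sum>k\<in>UNIV.
       X y $ k * partial k (\<lambda>p. J p $ i $ j) y
     - partial k (\<lambda>p. X p $ i) y * J y $ k $ j
     + partial j (\<lambda>p. X p $ k) y * J y $ i $ k)"

text \<open>Calabi's condition: the gradient of the scalar curvature is a real holomorphic vector field.\<close>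
definition extremal_at ::
  "(real^'n \<Rightarrow> real^'n^'n) \<Rightarrow> (real^'n \<Rightarrow> real^'n^'n) \<Rightarrow> real^'n::finite \<Rightarrow> bool" where
  "extremal_at G W y \<longleftrightarrow>
     (\<forall>i j. lie_deriv_endo (gradient G (scalar_curvature G)) (complex_structure G W) i j y = 0)"

subsection \<open>Riemann surfaces and constant curvature metrics\<close>

type_synonym 's chart = "'s set \<times> ('s \<Rightarrow> complex)"

record 's surface =
  surf_top :: "'s topology"
  surf_atlas :: "'s chart set"

definition chart_pt :: "'s chart \<Rightarrow> complex \<Rightarrow> 's" where
  "chart_pt c = inv_into (fst c) (snd c)"

definition chart_change :: "'s chart \<Rightarrow> 's chart \<Rightarrow> complex \<Rightarrow> complex" where
  "chart_change c c' = snd c' \<circ> chart_pt c"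

definition riemann_surface :: "'s surface \<Rightarrow> bool" where
  "riemann_surface S \<longleftrightarrow>
     Hausdorff_space (surf_top S) \<and> connected_space (surf_top S) \<and>
     \<Union> (fst ` surf_atlas S) = topspace (surf_top S) \<and>
     (\<forall>c\<in>surf_atlas S. openin (surf_top S) (fst c) \<and> open (snd c ` fst c) \<and>
        homeomorphic_map (subtopology (surf_top S) (fst c)) (top_of_set (snd c ` fst c)) (snd c)) \<and>
     (\<forall>c\<in>surf_atlas S. \<forall>c'\<in>surf_atlas S.
        chart_change c c' holomorphic_on snd c ` (fst c \<inter> fst c'))"

definition compact_riemann_surface :: "'s surface \<Rightarrow> bool" where
  "compact_riemann_surface S \<longleftrightarrow> riemann_surface S \<and> compact_space (surf_top S)"

definition has_genus :: "'s surface \<Rightarrow> nat \<Rightarrow> bool" where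
  "has_genus S n \<longleftrightarrow> homology_group 1 (surf_top S) \<cong> free_Abelian_group {..<2 * n}"

text \<open>A Kaehler metric on a Riemann surface is given by its conformal factor: in a chart
  \<open>w = u + i v\<close> one has \<open>g = lam c (du\<^sup>2 + dv\<^sup>2)\<close> and \<open>\<omega> = lam c du \<and> dv\<close>.\<close>

definition surface_metric :: "'s surface \<Rightarrow> ('s chart \<Rightarrow> complex \<Rightarrow> real) \<Rightarrow> bool" where
  "surface_metric S lam \<longleftrightarrow>
     (\<forall>c\<in>surf_atlas S. smooth_on (lam c) (snd c ` fst c) \<and> (\<forall>w\<in>snd c ` fst c. lam c w > 0)) \<and>
     (\<forall>c\<in>surf_atlas S. \<forall>c'\<in>surf_atlas S. \<forall>w\<in>snd c ` (fst c \<inter> fst c').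
        lam c w = lam c' (chart_change c c' w) * (cmod (deriv (chart_change c c') w))\<^sup>2)"

definition constant_curvature_metric :: "'s surface \<Rightarrow> ('s chart \<Rightarrow> complex \<Rightarrow> real) \<Rightarrow> bool" where
  "constant_curvature_metric S lam \<longleftrightarrow> surface_metric S lam \<and>
     (\<exists>r. \<forall>c\<in>surf_atlas S. \<forall>y::real^2. Complex (y $ 1) (y $ 2) \<in> snd c ` fst c \<longrightarrow>
        scalar_curvature (\<lambda>p::real^2. lam c (Complex (p $ 1) (p $ 2)) *\<^sub>R mat 1) y = r)"

text \<open>A real 1-form on an open set of the plane is a complex-valued function \<open>a\<close>, standing for
  \<open>X \<mapsto> a w \<bullet> X\<close>, i.e. for \<open>Re a du + Im a dv\<close>. The coefficient of \<open>du \<and> dv\<close> in its exterior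
  derivative is \<open>ext_deriv a\<close>.\<close>

definition ext_deriv :: "(complex \<Rightarrow> complex) \<Rightarrow> complex \<Rightarrow> real" where
  "ext_deriv a w = dir_deriv 1 (\<lambda>w. Im (a w)) w - dir_deriv \<i> (\<lambda>w. Re (a w)) w"

definition surface_one_form :: "'s surface \<Rightarrow> ('s chart \<Rightarrow> complex \<Rightarrow> complex) \<Rightarrow> bool" where
  "surface_one_form S \<beta> \<longleftrightarrow>
     (\<forall>c\<in>surf_atlas S. smooth_on (\<beta> c) (snd c ` fst c)) \<and>
     (\<forall>c\<in>surf_atlas S. \<forall>c'\<in>surf_atlas S. \<forall>w\<in>snd c ` (fst c \<inter> fst c'). \<forall>X.
        \<beta> c' (chart_change c c' w) \<bullet> (deriv (chart_change c c') w * X) = \<beta> c w \<bullet> X)"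

subsection \<open>Holomorphic line bundles, connections, first Chern class\<close>

text \<open>A trivialization over \<open>U\<close> is a pair \<open>(U, \<tau>)\<close>, where \<open>\<tau>\<close> is the fibre coordinate.\<close>
type_synonym ('s, 'e) triv = "'s set \<times> ('e \<Rightarrow> complex)"

record ('s, 'e) line_bundle =
  bun_total :: "'e set"
  bun_proj :: "'e \<Rightarrow> 's"
  bun_trivs :: "('s, 'e) triv set"

definition bun_vec :: "('s, 'e) line_bundle \<Rightarrow> ('s, 'e) triv \<Rightarrow> 's \<Rightarrow> complex \<Rightarrow> 'e" where
  "bun_vec L u p \<zeta> = (THE e. e \<in> bun_total L \<and> bun_proj L e = p \<and> snd u e = \<zeta>)"

definition transition :: "('s, 'e) line_bundle \<Rightarrow> ('s, 'e) triv \<Rightarrow> ('s, 'e) triv \<Rightarrow> 's \<Rightarrow> complex" where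
  "transition L u u' p = snd u' (bun_vec L u p 1)"

definition holomorphic_line_bundle :: "'s surface \<Rightarrow> ('s, 'e) line_bundle \<Rightarrow> bool" where
  "holomorphic_line_bundle S L \<longleftrightarrow>
     bun_proj L ` bun_total L \<subseteq> topspace (surf_top S) \<and>
     \<Union> (fst ` bun_trivs L) = topspace (surf_top S) \<and>
     (\<forall>u\<in>bun_trivs L. openin (surf_top S) (fst u) \<and>
        bij_betw (\<lambda>e. (bun_proj L e, snd u e)) {e \<in> bun_total L. bun_proj L e \<in> fst u}
          (fst u \<times> UNIV)) \<and>
     (\<forall>u\<in>bun_trivs L. \<forall>u'\<in>bun_trivs L.
        (\<forall>e\<in>bun_total L. bun_proj L e \<in> fst u \<inter> fst u' \<longrightarrow>
           transition L u u' (bun_proj L e) \<noteq> 0 \<and>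
           snd u' e = transition L u u' (bun_proj L e) * snd u e) \<and>
        (\<forall>c\<in>surf_atlas S. (transition L u u' \<circ> chart_pt c)
           holomorphic_on snd c ` (fst c \<inter> fst u \<inter> fst u')))"

definition joint_dom :: "'s chart \<Rightarrow> ('s, 'e) triv \<Rightarrow> complex set" where
  "joint_dom c u = snd c ` (fst c \<inter> fst u)"

text \<open>A unitary connection on \<open>L\<close>, i.e. a principal connection on the circle bundle of unit vectors:
  in the chart \<open>c\<close> and the unit frame obtained by normalizing the frame of \<open>u\<close> it reads
  \<open>\<nabla> \<zeta> = d\<zeta> + i \<alpha> \<zeta>\<close> with the real 1-form \<open>\<alpha> = \<alpha> c u\<close>. Under a change of trivialization
  \<open>\<zeta>' = h \<zeta>\<close> one has \<open>\<alpha>' = \<alpha> - d arg h\<close>, where \<open>d arg h (X) = Im (h' X / h)\<close>.\<close>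

definition unitary_connection ::
  "'s surface \<Rightarrow> ('s, 'e) line_bundle \<Rightarrow> ('s chart \<Rightarrow> ('s, 'e) triv \<Rightarrow> complex \<Rightarrow> complex) \<Rightarrow> bool" where
  "unitary_connection S L \<alpha> \<longleftrightarrow>
     (\<forall>c\<in>surf_atlas S. \<forall>u\<in>bun_trivs L. smooth_on (\<alpha> c u) (joint_dom c u)) \<and>
     (\<forall>c\<in>surf_atlas S. \<forall>c'\<in>surf_atlas S. \<forall>u\<in>bun_trivs L. \<forall>u'\<in>bun_trivs L.
        \<forall>w\<in>snd c ` (fst c \<inter> fst c' \<inter> fst u \<inter> fst u'). \<forall>X.
          (let h = transition L u u' \<circ> chart_pt c in
             \<alpha> c' u' (chart_change c c' w) \<bullet> (deriv (chart_change c c') w * X)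
               = \<alpha> c u w \<bullet> X - Im (deriv h w * X / h w)))"

text \<open>The closed 2-form \<open>\<sigma> c du \<and> dv\<close> represents \<open>c\<^sub>1(L)\<close> in de Rham cohomology. By Chern--Weil
  theory the class is that of \<open>i F / (2 \<pi>)\<close>, where \<open>F = i d\<alpha>\<close> is the curvature of any connection.\<close>
definition represents_c1 ::
  "'s surface \<Rightarrow> ('s, 'e) line_bundle \<Rightarrow> ('s chart \<Rightarrow> complex \<Rightarrow> real) \<Rightarrow> bool" where
  "represents_c1 S L \<sigma> \<longleftrightarrow>
     (\<exists>\<alpha> \<beta>. unitary_connection S L \<alpha> \<and> surface_one_form S \<beta> \<and>
        (\<forall>c\<in>surf_atlas S. \<forall>u\<in>bun_trivs L. \<forall>w\<in>joint_dom c u.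
           \<sigma> c w = - ext_deriv (\<alpha> c u) w / (2 * pi) + ext_deriv (\<beta> c) w))"

subsection \<open>The ruled surface P(O + L) and its Morse--Bott function\<close>

definition zero_vec :: "('s, 'e) line_bundle \<Rightarrow> 'e \<Rightarrow> bool" where
  "zero_vec L e \<longleftrightarrow> (\<forall>u\<in>bun_trivs L. bun_proj L e \<in> fst u \<longrightarrow> snd u e = 0)"

definition bun_scale :: "('s, 'e) line_bundle \<Rightarrow> complex \<Rightarrow> 'e \<Rightarrow> 'e" where
  "bun_scale L k e = (THE e'. e' \<in> bun_total L \<and> bun_proj L e' = bun_proj L e \<and>
     (\<forall>u\<in>bun_trivs L. bun_proj L e \<in> fst u \<longrightarrow> snd u e' = k * snd u e))"

text \<open>The point \<open>[a : e]\<close>, as the set of nonzero multiples of \<open>(a, e)\<close>.\<close>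
definition proj_pt :: "('s, 'e) line_bundle \<Rightarrow> complex \<Rightarrow> 'e \<Rightarrow> (complex \<times> 'e) set" where
  "proj_pt L a e = {(k * a, bun_scale L k e) | k. k \<noteq> 0}"

definition ruled_surface :: "('s, 'e) line_bundle \<Rightarrow> (complex \<times> 'e) set set" where
  "ruled_surface L = {proj_pt L a e | a e. e \<in> bun_total L \<and> (a \<noteq> 0 \<or> \<not> zero_vec L e)}"

definition zero_section :: "('s, 'e) line_bundle \<Rightarrow> (complex \<times> 'e) set set" where
  "zero_section L = {proj_pt L 1 e | e. e \<in> bun_total L \<and> zero_vec L e}"

definition infinity_section :: "('s, 'e) line_bundle \<Rightarrow> (complex \<times> 'e) set set" where
  "infinity_section L = {proj_pt L 0 e | e. e \<in> bun_total L \<and> \<not> zero_vec L e}"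

text \<open>The two kinds of standard holomorphic coordinates \<open>(w, \<zeta>)\<close>, covering the complement of the
  infinity section and of the zero section, respectively. In both, \<open>\<zeta> = 0\<close> is the other section.\<close>

definition affine_param ::
  "('s, 'e) line_bundle \<Rightarrow> 's chart \<Rightarrow> ('s, 'e) triv \<Rightarrow> complex \<times> complex \<Rightarrow> (complex \<times> 'e) set" where
  "affine_param L c u q = proj_pt L 1 (bun_vec L u (chart_pt c (fst q)) (snd q))"

definition infinity_param ::
  "('s, 'e) line_bundle \<Rightarrow> 's chart \<Rightarrow> ('s, 'e) triv \<Rightarrow> complex \<times> complex \<Rightarrow> (complex \<times> 'e) set" where
  "infinity_param L c u q = proj_pt L (snd q) (bun_vec L u (chart_pt c (fst q)) 1)"

text \<open>A smooth function of \<open>(w, \<zeta>)\<close> that is critical exactly along \<open>\<zeta> = 0\<close>, with Hessian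
  nondegenerate in the normal direction. Off the critical set the derivative along the fibre is
  required not to vanish: this is forced by the gradient of \<open>z\<close> being vertical for every
  admissible metric.\<close>
definition morse_bott_local :: "complex set \<Rightarrow> (complex \<times> complex \<Rightarrow> real) \<Rightarrow> bool" where
  "morse_bott_local D f \<longleftrightarrow> smooth_on f (D \<times> UNIV) \<and>
     (\<forall>w\<in>D. \<forall>X. dir_deriv X f (w, 0) = 0) \<and>
     (\<forall>w\<in>D. \<forall>X. X \<noteq> 0 \<longrightarrow> (\<exists>Y. dir_deriv (0, Y) (dir_deriv (0, X) f) (w, 0) \<noteq> 0)) \<and>
     (\<forall>w\<in>D. \<forall>\<zeta>. \<zeta> \<noteq> 0 \<longrightarrow> (\<exists>X. dir_deriv (0, X) f (w, \<zeta>) \<noteq> 0))"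

text \<open>The circle acts by \<open>[a : e] \<mapsto> [exp (i s) a : e]\<close>, i.e. by \<open>exp (- i s)\<close> on \<open>L\<close>. With this
  orientation, and \<open>z = 1\<close> on the zero section, the sign conventions \<open>d\<theta> = \<omega>\<close>, \<open>K = J grad z\<close> and
  \<open>c\<^sub>1(L) = [\<omega>] / (2 \<pi>)\<close> are compatible: for \<open>x > 0\<close> the zero section, whose normal bundle is \<open>L\<close>,
  has the larger area.\<close>
definition morse_bott_function ::
  "'s surface \<Rightarrow> ('s, 'e) line_bundle \<Rightarrow> ((complex \<times> 'e) set \<Rightarrow> real) \<Rightarrow> bool" where
  "morse_bott_function S L z \<longleftrightarrow>
     z ` ruled_surface L \<subseteq> {-1..1} \<and>
     {m \<in> ruled_surface L. z m = 1} = zero_section L \<and>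
     {m \<in> ruled_surface L. z m = -1} = infinity_section L \<and>
     (\<forall>a e s. proj_pt L a e \<in> ruled_surface L \<longrightarrow>
        z (proj_pt L (cis s * a) e) = z (proj_pt L a e)) \<and>
     (\<forall>c\<in>surf_atlas S. \<forall>u\<in>bun_trivs L.
        morse_bott_local (joint_dom c u) (z \<circ> affine_param L c u) \<and>
        morse_bott_local (joint_dom c u) (z \<circ> infinity_param L c u))"

definition regular_part ::
  "('s, 'e) line_bundle \<Rightarrow> ((complex \<times> 'e) set \<Rightarrow> real) \<Rightarrow> (complex \<times> 'e) set set" where
  "regular_part L z = {m \<in> ruled_surface L. -1 < z m \<and> z m < 1}"

subsection \<open>Admissible metrics\<close>

text \<open>On the regular part we use the coordinates \<open>y = (u, v, z, t)\<close>, where \<open>u + i v\<close> is a chart of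
  the base and \<open>t\<close> is the angle of the circle action in a trivialization (so \<open>\<zeta> / |\<zeta>| = exp (- i t)\<close>
  and \<open>K = \<partial>/\<partial>t\<close>); \<open>t\<close> is determined up to multiples of \<open>2 \<pi>\<close>, and all choices are allowed.\<close>
definition regular_coords ::
  "('s, 'e) line_bundle \<Rightarrow> ((complex \<times> 'e) set \<Rightarrow> real) \<Rightarrow> 's chart \<Rightarrow> ('s, 'e) triv \<Rightarrow>
   (complex \<times> 'e) set \<Rightarrow> real^4 \<Rightarrow> bool" where
  "regular_coords L z c u m y \<longleftrightarrow>
     (\<exists>e\<in>bun_total L. m = proj_pt L 1 e \<and> bun_proj L e \<in> fst c \<inter> fst u \<and>
        Complex (y $ 1) (y $ 2) = snd c (bun_proj L e) \<and> y $ 3 = z m \<and>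
        snd u e \<noteq> 0 \<and> snd u e = of_real (cmod (snd u e)) * cis (- y $ 4))"

definition tensor :: "real^'n \<Rightarrow> real^'n \<Rightarrow> real^'n::finite^'n" where
  "tensor a b = (\<chi> i j. a $ i * b $ j)"

definition wedge :: "real^'n \<Rightarrow> real^'n \<Rightarrow> real^'n::finite^'n" where
  "wedge a b = tensor a b - tensor b a"

definition du :: "real^4" where "du = axis 1 1"
definition dv :: "real^4" where "dv = axis 2 1"
definition dz :: "real^4" where "dz = axis 3 1"
definition dt :: "real^4" where "dt = axis 4 1"

definition base_pt :: "real^4 \<Rightarrow> complex" where
  "base_pt y = Complex (y $ 1) (y $ 2)"

text \<open>The connection 1-form of the unitary connection \<open>\<alpha>\<close> with respect to \<open>K\<close>: it satisfies
  \<open>\<theta>(K) = 1\<close>, and it vanishes on horizontal vectors, for which \<open>dt = - d arg \<zeta> = \<alpha>\<close>.\<close>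
definition connection_form :: "(complex \<Rightarrow> complex) \<Rightarrow> real^4 \<Rightarrow> real^4" where
  "connection_form a y = dt - Re (a (base_pt y)) *\<^sub>R du - Im (a (base_pt y)) *\<^sub>R dv"

text \<open>\<open>d\<theta> = \<omega>\<close> on the base; by \<open>connection_form\<close>, \<open>d\<theta>\<close> is the pull-back of \<open>- d\<alpha>\<close>.\<close>
definition curvature_form_eq ::
  "'s surface \<Rightarrow> ('s, 'e) line_bundle \<Rightarrow> ('s chart \<Rightarrow> ('s, 'e) triv \<Rightarrow> complex \<Rightarrow> complex) \<Rightarrow>
   ('s chart \<Rightarrow> complex \<Rightarrow> real) \<Rightarrow> bool" where
  "curvature_form_eq S L \<alpha> lam \<longleftrightarrow>
     (\<forall>c\<in>surf_atlas S. \<forall>u\<in>bun_trivs L. \<forall>w\<in>joint_dom c u. - ext_deriv (\<alpha> c u) w = lam c w)"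

type_synonym ('s, 'e) tensor_field = "'s chart \<Rightarrow> ('s, 'e) triv \<Rightarrow> real^4 \<Rightarrow> real^4^4"

definition admissible_metric ::
  "('s chart \<Rightarrow> complex \<Rightarrow> real) \<Rightarrow> ('s chart \<Rightarrow> ('s, 'e) triv \<Rightarrow> complex \<Rightarrow> complex) \<Rightarrow>
   real \<Rightarrow> (real \<Rightarrow> real) \<Rightarrow> ('s, 'e) tensor_field" where
  "admissible_metric lam \<alpha> x \<Theta> c u y =
     (let \<theta> = connection_form (\<alpha> c u) y in
      ((1 + x * y $ 3) / x) *\<^sub>R lam c (base_pt y) *\<^sub>R (tensor du du + tensor dv dv)
      + (1 / \<Theta> (y $ 3)) *\<^sub>R tensor dz dz + \<Theta> (y $ 3) *\<^sub>R tensor \<theta> \<theta>)"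

definition admissible_form ::
  "('s chart \<Rightarrow> complex \<Rightarrow> real) \<Rightarrow> ('s chart \<Rightarrow> ('s, 'e) triv \<Rightarrow> complex \<Rightarrow> complex) \<Rightarrow>
   real \<Rightarrow> ('s, 'e) tensor_field" where
  "admissible_form lam \<alpha> x c u y =
     ((1 + x * y $ 3) / x) *\<^sub>R lam c (base_pt y) *\<^sub>R wedge du dv
      + wedge dz (connection_form (\<alpha> c u) y)"

definition profiles :: "real \<Rightarrow> (real \<Rightarrow> real) set" where
  "profiles \<kappa> = {\<Theta>. smooth_on_Icc \<Theta> (-1) 1 \<and> (\<forall>s\<in>{-1<..<1}. \<Theta> s > 0) \<and>
     \<Theta> (-1) = 0 \<and> \<Theta> 1 = 0 \<and>
     (\<Theta> has_real_derivative 2 * \<kappa>) (at (-1) within {-1..1}) \<and>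
     (\<Theta> has_real_derivative - 2 * \<kappa>) (at 1 within {-1..1})}"

text \<open>The conical admissible metrics with angle \<open>2 \<pi> \<kappa>\<close>, each paired with its Kaehler form.\<close>
definition conical_class ::
  "('s chart \<Rightarrow> complex \<Rightarrow> real) \<Rightarrow> ('s chart \<Rightarrow> ('s, 'e) triv \<Rightarrow> complex \<Rightarrow> complex) \<Rightarrow>
   real \<Rightarrow> real \<Rightarrow> (('s, 'e) tensor_field \<times> ('s, 'e) tensor_field) set" where
  "conical_class lam \<alpha> x \<kappa> =
     {(admissible_metric lam \<alpha> x \<Theta>, admissible_form lam \<alpha> x) | \<Theta>. \<Theta> \<in> profiles \<kappa>}"

definition extremal_kaehler ::
  "'s surface \<Rightarrow> ('s, 'e) line_bundle \<Rightarrow> ((complex \<times> 'e) set \<Rightarrow> real) \<Rightarrow>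
   ('s, 'e) tensor_field \<Rightarrow> ('s, 'e) tensor_field \<Rightarrow> bool" where
  "extremal_kaehler S L z g \<omega> \<longleftrightarrow>
     (\<forall>c\<in>surf_atlas S. \<forall>u\<in>bun_trivs L. \<forall>m\<in>regular_part L z. \<forall>y.
        regular_coords L z c u m y \<longrightarrow> kaehler_at (g c u) (\<omega> c u) y \<and> extremal_at (g c u) (\<omega> c u) y)"

end

theory Submission
  imports Defs
begin

text \<open>Write \<open>a = 1 / x > 1\<close>, so that the base metric is scaled by \<open>z + a\<close>. For a base of constant
  scalar curvature \<open>r\<close>, an admissible metric with profile \<open>\<Theta>\<close> has scalar curvature
  \<open>(r - F''(z)) / (z + a)\<close>, where \<open>F(z) = (z + a) \<Theta>(z)\<close>; and if this is an affine function of \<open>z\<close>,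
  its gradient is a multiple of \<open>\<Theta> \<partial>\<^sub>z = - J K\<close>, which is holomorphic. So the metric is extremal
  as soon as \<open>F\<close> is a polynomial of degree at most four with \<open>F''(- a) = r\<close>. The boundary conditions
  on \<open>\<Theta>\<close> amount to \<open>F(z) = \<kappa> (1 - z\<^sup>2) (z + a + C (1 - z\<^sup>2))\<close>, and the condition at \<open>- a\<close> becomes
  \<open>r = \<kappa> (C (12 a\<^sup>2 - 4) + 4 a)\<close>. What remains is positivity of \<open>\<Theta>\<close> inside the interval.
  It holds whenever \<open>C \<ge> - 1/2\<close>, because \<open>z + a - (1 - z\<^sup>2) / 2 = (a - 1) + (1 + z)\<^sup>2 / 2\<close>. As \<open>\<kappa>\<close> tends
  to infinity with \<open>r\<close> fixed, \<open>C\<close> tends to \<open>- a / (3 a\<^sup>2 - 1)\<close>, which is greater than \<open>- 1/2\<close> since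
  \<open>3 a\<^sup>2 - 2 a - 1 = (3 a + 1) (a - 1) > 0\<close>. So every large cone angle is admitted
  (\<open>exists_profile_parameters\<close>).

  The curvature is computed in the coordinates \<open>(u, v, z, t)\<close>. The metric is diagonal in the coframe
  \<open>du, dv, dz, \<theta>\<close>, and the Christoffel symbols have a short description as bilinear forms in it
  (\<open>christoffel_G\<close>). They give the components of the Ricci tensor that the scalar curvature
  involves (\<open>ricci_G\<close>); the connection contributes through its curvature \<open>d\<theta> = \<omega>\<close>. The same
  calculus, applied to a conformal metric on a plane domain (\<open>scalar_curvature_conformal\<close>),
  identifies the term coming from the base, which equals \<open>r\<close> by the constant curvature hypothesis.\<close>

section \<open>A calculus of coordinate derivatives\<close>

text \<open>With differentiability along a coordinate line as a predicate, the rules below make \<open>partial\<close>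
  computable by conditional rewriting.\<close>

definition has_partial :: "'n::finite \<Rightarrow> (real^'n \<Rightarrow> real) \<Rightarrow> real^'n \<Rightarrow> bool" where
  "has_partial i g y \<longleftrightarrow> (\<lambda>t. g (y + t *\<^sub>R axis i 1)) field_differentiable (at 0)"

text \<open>A derivative at \<open>y\<close> sees only a neighbourhood of \<open>y\<close>, so closed forms that hold on an open set
  may be substituted before differentiating again.\<close>
lemma partial_cong:
  assumes "open U" "y \<in> U" "\<And>p. p \<in> U \<Longrightarrow> g p = g' p"
  shows "partial i g y = partial i g' y"
proof -
  have "((\<lambda>t. y + t *\<^sub>R axis i 1) \<longlongrightarrow> y + 0 *\<^sub>R axis i 1) (at (0::real))"
    by (intro tendsto_intros)
  then have "eventually (\<lambda>t. y + t *\<^sub>R axis i 1 \<in> U) (nhds (0::real))"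
    using assms(1,2) by (auto simp: eventually_nhds_conv_at dest!: topological_tendstoD[of _ _ _ U])
  then have "eventually (\<lambda>t. g (y + t *\<^sub>R axis i 1) = g' (y + t *\<^sub>R axis i 1)) (nhds 0)"
    by eventually_elim (use assms(3) in auto)
  then show ?thesis
    unfolding partial_def dir_deriv_def by (rule deriv_cong_ev) simp
qed

lemma has_partial_const: "has_partial i (\<lambda>p. k) y"
  and has_partial_add:
    "has_partial i g y \<Longrightarrow> has_partial i g' y \<Longrightarrow> has_partial i (\<lambda>p. g p + g' p) y"
  and has_partial_diff:
    "has_partial i g y \<Longrightarrow> has_partial i g' y \<Longrightarrow> has_partial i (\<lambda>p. g p - g' p) y"
  and has_partial_minus: "has_partial i g y \<Longrightarrow> has_partial i (\<lambda>p. - g p) y"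
  and has_partial_mult:
    "has_partial i g y \<Longrightarrow> has_partial i g' y \<Longrightarrow> has_partial i (\<lambda>p. g p * g' p) y"
  and has_partial_divide:
    "has_partial i g y \<Longrightarrow> has_partial i g' y \<Longrightarrow> g' y \<noteq> 0 \<Longrightarrow> has_partial i (\<lambda>p. g p / g' p) y"
  by (auto simp: has_partial_def intro!: derivative_intros field_differentiable_divide)

lemma partial_const: "partial i (\<lambda>p. k) y = 0"
  and partial_add: "has_partial i g y \<Longrightarrow> has_partial i g' y \<Longrightarrow>
    partial i (\<lambda>p. g p + g' p) y = partial i g y + partial i g' y"
  and partial_diff: "has_partial i g y \<Longrightarrow> has_partial i g' y \<Longrightarrow>
    partial i (\<lambda>p. g p - g' p) y = partial i g y - partial i g' y"
  and partial_minus: "has_partial i g y \<Longrightarrow> partial i (\<lambda>p. - g p) y = - partial i g y"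
  and partial_mult: "has_partial i g y \<Longrightarrow> has_partial i g' y \<Longrightarrow>
    partial i (\<lambda>p. g p * g' p) y = g y * partial i g' y + partial i g y * g' y"
  and partial_divide: "has_partial i g y \<Longrightarrow> has_partial i g' y \<Longrightarrow> g' y \<noteq> 0 \<Longrightarrow>
    partial i (\<lambda>p. g p / g' p) y = (partial i g y * g' y - g y * partial i g' y) / (g' y)\<^sup>2"
  by (simp_all add: has_partial_def partial_def dir_deriv_def deriv_divide power2_eq_square)

lemmas partial_rules =
  has_partial_const has_partial_add has_partial_diff has_partial_minus has_partial_mult
  has_partial_divide
  partial_const partial_add partial_diff partial_minus partial_mult partial_divide

lemma matrix_inv_eqI:
  fixes A B :: "real^'n::finite^'n"
  assumes "A ** B = mat 1"
  shows "matrix_inv A = B"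
proof -
  have B: "B ** A = mat 1"
    using assms matrix_left_right_inverse by blast
  have "A ** matrix_inv A = mat 1"
    unfolding matrix_inv_def using assms B by (metis (mono_tags, lifting) someI_ex)
  then show ?thesis
    using B by (metis matrix_mul_assoc matrix_mul_lid matrix_mul_rid)
qed

lemma axis_plus_nth:
  "(y + t *\<^sub>R axis k 1 :: real^'n::finite) $ i = (if i = k then y $ i + t else y $ i)"
  by (simp add: axis_def)

lemma partial_nth: "partial i (\<lambda>p. p $ k) y = (if i = k then 1 else 0)"
  unfolding partial_def dir_deriv_def axis_plus_nth by auto

lemma has_partial_nth: "has_partial i (\<lambda>p. p $ k) y"
  by (auto simp: has_partial_def axis_plus_nth intro!: derivative_intros)

lemma partial_of_nth:
  assumes "(F has_real_derivative F') (at (y $ k))"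
  shows "has_partial i (\<lambda>p. F (p $ k)) y"
    and "partial i (\<lambda>p. F (p $ k)) y = (if i = k then F' else 0)"
proof -
  have "((\<lambda>t. F (y $ k + t)) has_real_derivative F') (at 0)"
    using assms DERIV_shift[of F F' 0 "y $ k"] by (simp add: add.commute)
  then have "((\<lambda>t. F ((y + t *\<^sub>R axis i 1) $ k)) has_real_derivative (if i = k then F' else 0)) (at 0)"
    unfolding axis_plus_nth by auto
  then show "has_partial i (\<lambda>p. F (p $ k)) y"
    and "partial i (\<lambda>p. F (p $ k)) y = (if i = k then F' else 0)"
    unfolding has_partial_def partial_def dir_deriv_def
    by (auto simp: field_differentiable_def dest: DERIV_imp_deriv)
qed

lemma partial_compose:
  assumes "\<And>t. \<pi> (y + t *\<^sub>R axis i 1) = \<pi> y + t *\<^sub>R b"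
  shows "partial i (\<lambda>p. F (\<pi> p)) y = dir_deriv b F (\<pi> y)"
  by (simp only: partial_def dir_deriv_def assms)

lemma has_partial_compose:
  assumes \<pi>: "\<And>t. \<pi> (y + t *\<^sub>R axis i 1) = \<pi> y + t *\<^sub>R b" and F: "F differentiable (at (\<pi> y))"
  shows "has_partial i (\<lambda>p. F (\<pi> p)) y"
proof -
  have "(\<lambda>t. F (\<pi> y + t *\<^sub>R b)) differentiable (at 0)"
    by (rule differentiable_chain_at[unfolded o_def, where g = F]) (use F in simp_all)
  then show ?thesis
    unfolding has_partial_def \<pi> by (simp add: field_differentiable_def real_differentiable_def)
qed

lemma dir_deriv_eq_frechet:
  assumes "F differentiable (at w)"
  shows "dir_deriv b F w = frechet_derivative F (at w) b"
proof -
  have F: "(F has_derivative frechet_derivative F (at w)) (at (w + 0 *\<^sub>R b))"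
    using assms[unfolded frechet_derivative_works] by simp
  have "((\<lambda>t. w + t *\<^sub>R b) has_derivative (\<lambda>t. t *\<^sub>R b)) (at (0::real))"
    by (auto intro!: derivative_eq_intros)
  from has_derivative_compose[OF this F]
  have "((\<lambda>t. F (w + t *\<^sub>R b)) has_derivative (\<lambda>t. frechet_derivative F (at w) (t *\<^sub>R b))) (at 0)" .
  then have "((\<lambda>t. F (w + t *\<^sub>R b)) has_real_derivative frechet_derivative F (at w) b) (at 0)"
    using linear_frechet_derivative[OF assms]
    by (simp add: has_field_derivative_def linear_cmul mult_commute_abs
        mult.commute[of _ "frechet_derivative F (at w) b"])
  then show ?thesis
    unfolding dir_deriv_def by (rule DERIV_imp_deriv)
qed

lemma smooth_onD:
  assumes "smooth_on F D" "open D" "w \<in> D"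
  shows "F differentiable (at w)"
  using assms Ck_on.simps(2)[of 0 F D] unfolding smooth_on_def
  by (metis differentiable_on_eq_differentiable_at)

lemma smooth_on_dir_deriv:
  fixes F :: "'a::euclidean_space \<Rightarrow> real"
  assumes F: "smooth_on F D" and D: "open D" "w \<in> D" and b: "b \<in> Basis"
  shows "dir_deriv b F differentiable (at w)"
proof -
  have "Ck_on (Suc (Suc 0)) F D"
    using F by (simp only: smooth_on_def)
  then have "(\<lambda>w. frechet_derivative F (at w) b) differentiable_on D"
    using b by auto
  then have "(\<lambda>w. frechet_derivative F (at w) b) differentiable (at w)"
    using D differentiable_on_eq_differentiable_at by blast
  then obtain A where "((\<lambda>w. frechet_derivative F (at w) b) has_derivative A) (at w)"
    by (auto simp: differentiable_def)
  moreover have "frechet_derivative F (at v) b = dir_deriv b F v" if "v \<in> D" for v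
    using dir_deriv_eq_frechet[OF smooth_onD[OF F D(1) that]] by simp
  ultimately have "(dir_deriv b F has_derivative A) (at w)"
    using has_derivative_transform_within_open[OF _ D] by blast
  then show ?thesis
    by (auto simp: differentiable_def)
qed

section \<open>Conformal metrics on plane domains\<close>

text \<open>This is \<open>- \<Delta> log lam / lam\<close>, twice the Gauss curvature of \<open>lam (du\<^sup>2 + dv\<^sup>2)\<close>.\<close>
definition conformal_curvature :: "(complex \<Rightarrow> real) \<Rightarrow> complex \<Rightarrow> real" where
  "conformal_curvature lam w =
     - ((dir_deriv 1 (dir_deriv 1 lam) w + dir_deriv \<i> (dir_deriv \<i> lam) w) / lam w
        - ((dir_deriv 1 lam w)\<^sup>2 + (dir_deriv \<i> lam w)\<^sup>2) / (lam w)\<^sup>2) / lam w"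

locale conformal_chart =
  fixes D :: "complex set" and lam :: "complex \<Rightarrow> real"
  assumes open_D: "open D"
    and lam_pos: "w \<in> D \<Longrightarrow> lam w > 0"
    and lam_diff: "w \<in> D \<Longrightarrow> lam differentiable (at w)"
    and lam_diff_1: "w \<in> D \<Longrightarrow> dir_deriv 1 lam differentiable (at w)"
    and lam_diff_i: "w \<in> D \<Longrightarrow> dir_deriv \<i> lam differentiable (at w)"
begin

definition pt :: "real^2 \<Rightarrow> complex" where "pt y = Complex (y $ 1) (y $ 2)"

definition plane_dom :: "(real^2) set" where "plane_dom = pt -` D"

definition g :: "real^2 \<Rightarrow> real^2^2" where "g y = lam (pt y) *\<^sub>R mat 1"

definition grad_lam :: "real^2 \<Rightarrow> real^2" where
  "grad_lam y = vector [dir_deriv 1 lam (pt y), dir_deriv \<i> lam (pt y)]"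

lemma grad_lam_nth:
  "grad_lam y $ 1 = dir_deriv 1 lam (pt y)" "grad_lam y $ 2 = dir_deriv \<i> lam (pt y)"
  by (simp_all add: grad_lam_def)

definition conformal_christoffel :: "2 \<Rightarrow> 2 \<Rightarrow> 2 \<Rightarrow> real^2 \<Rightarrow> real" where
  "conformal_christoffel k i j y =
     ((if k = i then grad_lam y $ j else 0) + (if k = j then grad_lam y $ i else 0)
        - (if i = j then grad_lam y $ k else 0)) / (2 * lam (pt y))"

lemma pt_plus:
  "pt (y + t *\<^sub>R axis 1 1) = pt y + t *\<^sub>R 1"
  "pt (y + t *\<^sub>R axis 2 1) = pt y + t *\<^sub>R \<i>"
  by (simp_all add: pt_def complex_eq_iff axis_def)

lemmas partial_pt = pt_plus[THEN partial_compose]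

lemma has_partial_pt: "F differentiable (at (pt y)) \<Longrightarrow> has_partial i (\<lambda>p. F (pt p)) y"
  using exhaust_2[of i] pt_plus[THEN has_partial_compose] by auto

lemma open_plane_dom: "open plane_dom"
proof -
  have "continuous_on UNIV pt"
    unfolding pt_def Complex_eq by (intro continuous_intros)
  then show ?thesis
    using open_D by (auto simp: plane_dom_def intro!: open_vimage)
qed

lemma has_partial_lam:
  assumes "y \<in> plane_dom"
  shows "has_partial i (\<lambda>p. lam (pt p)) y"
    "has_partial i (\<lambda>p. dir_deriv 1 lam (pt p)) y"
    "has_partial i (\<lambda>p. dir_deriv \<i> lam (pt p)) y"
  using assms by (simp_all add: plane_dom_def has_partial_pt lam_diff lam_diff_1 lam_diff_i)

lemma lam_pt: "y \<in> plane_dom \<Longrightarrow> lam (pt y) > 0"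
  by (simp add: plane_dom_def lam_pos)

lemma matrix_inv_g: "y \<in> plane_dom \<Longrightarrow> matrix_inv (g y) = (1 / lam (pt y)) *\<^sub>R mat 1"
  using lam_pt[of y]
  by (intro matrix_inv_eqI)
    (simp add: g_def vec_eq_iff forall_2 sum_2 matrix_matrix_mult_def mat_def)

lemma christoffel_g:
  assumes "y \<in> plane_dom"
  shows "christoffel g k i j y = conformal_christoffel k i j y"
proof -
  have "\<forall>k i j. christoffel g k i j y = conformal_christoffel k i j y"
    unfolding christoffel_def matrix_inv_g[OF assms] conformal_christoffel_def
    using lam_pt[OF assms]
    by (simp add: forall_2 sum_2 mat_def g_def grad_lam_nth partial_rules partial_pt
       has_partial_lam[OF assms] field_simps)
  then show ?thesis by blast
qed

lemma scalar_curvature_conformal: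
  assumes "y \<in> plane_dom"
  shows "scalar_curvature g y = conformal_curvature lam (pt y)"
proof -
  have ricci: "ricci g i j y =
      (\<Sum>k\<in>UNIV. partial k (conformal_christoffel k i j) y
         - partial j (conformal_christoffel k i k) y) +
      (\<Sum>k\<in>UNIV. \<Sum>l\<in>UNIV. conformal_christoffel k k l y * conformal_christoffel l i j y
         - conformal_christoffel k j l y * conformal_christoffel l i k y)" for i j
    unfolding ricci_def christoffel_g[OF assms]
    by (intro arg_cong2[of _ _ _ _ "(+)"] sum.cong arg_cong2[of _ _ _ _ "(-)"] refl
        partial_cong[OF open_plane_dom assms] christoffel_g)
  note nz = lam_pt[OF assms, THEN less_imp_neq, symmetric]
  show ?thesis
    unfolding scalar_curvature_def matrix_inv_g[OF assms] ricci conformal_christoffel_def[abs_def]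
    by (simp add: sum_2 mat_def grad_lam_nth partial_rules partial_pt has_partial_lam[OF assms] nz,
        insert lam_pt[OF assms],
        simp add: conformal_curvature_def field_simps power2_eq_square)
qed

end

section \<open>The metric in a chart of the regular part\<close>

definition symprod :: "real^'n \<Rightarrow> real^'n \<Rightarrow> real^'n::finite^'n" where
  "symprod a b = tensor a b + tensor b a"

text \<open>The connection form is \<open>\<theta> = dt - f du - h dv\<close>, and the hypothesis \<open>curvature\<close> is
  \<open>d\<theta> = lam du \<and> dv\<close>. Under \<open>a > 1\<close> the factor \<open>z + a\<close> is positive on the closed interval.\<close>
locale calabi_chart = conformal_chart D lam
  for D :: "complex set" and lam :: "complex \<Rightarrow> real" +
  fixes f h :: "complex \<Rightarrow> real" and a :: real and \<Theta> \<Theta>' \<Theta>'' :: "real \<Rightarrow> real"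
  assumes a_gt_1: "a > 1"
    and f_diff: "w \<in> D \<Longrightarrow> f differentiable (at w)"
    and h_diff: "w \<in> D \<Longrightarrow> h differentiable (at w)"
    and curvature: "w \<in> D \<Longrightarrow> dir_deriv \<i> f w = lam w + dir_deriv 1 h w"
    and \<Theta>_pos: "s \<in> {-1<..<1} \<Longrightarrow> \<Theta> s > 0"
    and \<Theta>_deriv: "s \<in> {-1<..<1} \<Longrightarrow> (\<Theta> has_real_derivative \<Theta>' s) (at s)"
    and \<Theta>'_deriv: "s \<in> {-1<..<1} \<Longrightarrow> (\<Theta>' has_real_derivative \<Theta>'' s) (at s)"
begin

definition chart_dom :: "(real^4) set" where
  "chart_dom = {y. base_pt y \<in> D \<and> -1 < y $ 3 \<and> y $ 3 < 1}"

text \<open>Kept as a constant of its own: the rewriting below has to see \<open>z + a\<close> as a single nonzero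
  factor rather than a sum to be multiplied out.\<close>
definition \<rho> :: "real^4 \<Rightarrow> real" where "\<rho> y = y $ 3 + a"

definition \<theta> :: "real^4 \<Rightarrow> real^4" where
  "\<theta> y = dt - f (base_pt y) *\<^sub>R du - h (base_pt y) *\<^sub>R dv"

definition G :: "real^4 \<Rightarrow> real^4^4" where
  "G y = (\<rho> y * lam (base_pt y)) *\<^sub>R (tensor du du + tensor dv dv)
     + (1 / \<Theta> (y $ 3)) *\<^sub>R tensor dz dz + \<Theta> (y $ 3) *\<^sub>R tensor (\<theta> y) (\<theta> y)"

definition W :: "real^4 \<Rightarrow> real^4^4" where
  "W y = (\<rho> y * lam (base_pt y)) *\<^sub>R wedge du dv + wedge dz (\<theta> y)"

text \<open>The horizontal lifts of \<open>\<partial>\<^sub>u\<close> and \<open>\<partial>\<^sub>v\<close>; with \<open>\<partial>\<^sub>z\<close> and \<open>\<partial>\<^sub>t\<close> they are dual to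
  \<open>du, dv, dz, \<theta>\<close>.\<close>
definition e\<^sub>u :: "real^4 \<Rightarrow> real^4" where "e\<^sub>u y = axis 1 1 + f (base_pt y) *\<^sub>R axis 4 1"
definition e\<^sub>v :: "real^4 \<Rightarrow> real^4" where "e\<^sub>v y = axis 2 1 + h (base_pt y) *\<^sub>R axis 4 1"

definition Ginv :: "real^4 \<Rightarrow> real^4^4" where
  "Ginv y = (1 / (\<rho> y * lam (base_pt y))) *\<^sub>R (tensor (e\<^sub>u y) (e\<^sub>u y) + tensor (e\<^sub>v y) (e\<^sub>v y))
     + \<Theta> (y $ 3) *\<^sub>R tensor (axis 3 1) (axis 3 1) + (1 / \<Theta> (y $ 3)) *\<^sub>R tensor (axis 4 1) (axis 4 1)"

definition J :: "real^4 \<Rightarrow> real^4^4" where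
  "J y = tensor (e\<^sub>v y) du - tensor (e\<^sub>u y) dv + (1 / \<Theta> (y $ 3)) *\<^sub>R tensor (axis 4 1) dz
     - \<Theta> (y $ 3) *\<^sub>R tensor (axis 3 1) (\<theta> y)"

lemmas tensor_defs = symprod_def tensor_def \<theta>_def du_def dv_def dz_def dt_def axis_def

lemma base_pt_plus:
  "base_pt (y + t *\<^sub>R axis 1 1) = base_pt y + t *\<^sub>R 1"
  "base_pt (y + t *\<^sub>R axis 2 1) = base_pt y + t *\<^sub>R \<i>"
  "base_pt (y + t *\<^sub>R axis 3 1) = base_pt y + t *\<^sub>R 0"
  "base_pt (y + t *\<^sub>R axis 4 1) = base_pt y + t *\<^sub>R 0"
  by (simp_all add: base_pt_def complex_eq_iff axis_def)

lemma partial_base: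
  "partial 1 (\<lambda>p. F (base_pt p)) y = dir_deriv 1 F (base_pt y)"
  "partial 2 (\<lambda>p. F (base_pt p)) y = dir_deriv \<i> F (base_pt y)"
  "partial 3 (\<lambda>p. F (base_pt p)) y = 0"
  "partial 4 (\<lambda>p. F (base_pt p)) y = 0"
  using base_pt_plus[THEN partial_compose, of F y] by (simp_all add: dir_deriv_def)

lemma has_partial_base:
  "F differentiable (at (base_pt y)) \<Longrightarrow> has_partial i (\<lambda>p. F (base_pt p)) y"
  using exhaust_4[of i] base_pt_plus[THEN has_partial_compose] by auto

lemma has_partial_base_vertical:
  "has_partial 3 (\<lambda>p. F (base_pt p)) y" "has_partial 4 (\<lambda>p. F (base_pt p)) y"
  by (simp_all add: has_partial_def base_pt_plus)

lemma open_chart_dom: "open chart_dom"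
proof -
  have "chart_dom = base_pt -` D \<inter> {y. -1 < y $ 3} \<inter> {y. y $ 3 < 1}"
    by (auto simp: chart_dom_def)
  moreover have "continuous_on UNIV base_pt"
    unfolding base_pt_def Complex_eq by (intro continuous_intros)
  ultimately show ?thesis
    using open_D by (auto intro!: open_Int open_vimage open_Collect_less continuous_intros)
qed

lemma chart_pos:
  assumes "y \<in> chart_dom"
  shows "lam (base_pt y) > 0" "\<rho> y > 0" "\<Theta> (y $ 3) > 0"
  using assms lam_pos[of "base_pt y"] a_gt_1 \<Theta>_pos[of "y $ 3"]
  by (auto simp: chart_dom_def \<rho>_def)

lemma chart_nonzero:
  assumes "y \<in> chart_dom"
  shows "lam (base_pt y) \<noteq> 0" "\<rho> y \<noteq> 0" "\<Theta> (y $ 3) \<noteq> 0"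
  using chart_pos[OF assms] by auto

lemma partial_\<rho>: "partial i \<rho> y = (if i = 3 then 1 else 0)"
  and has_partial_\<rho>: "has_partial i \<rho> y"
  unfolding \<rho>_def by (simp_all add: has_partial_nth partial_nth partial_rules)

lemma partial_data:
  assumes "y \<in> chart_dom"
  shows "has_partial i (\<lambda>p. lam (base_pt p)) y" "has_partial i (\<lambda>p. f (base_pt p)) y"
    "has_partial i (\<lambda>p. h (base_pt p)) y"
    "has_partial i (\<lambda>p. dir_deriv 1 lam (base_pt p)) y"
    "has_partial i (\<lambda>p. dir_deriv \<i> lam (base_pt p)) y"
    "has_partial i (\<lambda>p. \<Theta> (p $ 3)) y" "has_partial i (\<lambda>p. \<Theta>' (p $ 3)) y"
    "partial i (\<lambda>p. \<Theta> (p $ 3)) y = (if i = 3 then \<Theta>' (y $ 3) else 0)"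
    "partial i (\<lambda>p. \<Theta>' (p $ 3)) y = (if i = 3 then \<Theta>'' (y $ 3) else 0)"
proof -
  have "base_pt y \<in> D" and s: "y $ 3 \<in> {-1<..<1}"
    using assms by (simp_all add: chart_dom_def)
  then show "has_partial i (\<lambda>p. lam (base_pt p)) y" "has_partial i (\<lambda>p. f (base_pt p)) y"
    "has_partial i (\<lambda>p. h (base_pt p)) y"
    "has_partial i (\<lambda>p. dir_deriv 1 lam (base_pt p)) y"
    "has_partial i (\<lambda>p. dir_deriv \<i> lam (base_pt p)) y"
    by (simp_all only: has_partial_base lam_diff lam_diff_1 lam_diff_i f_diff h_diff)
  show "has_partial i (\<lambda>p. \<Theta> (p $ 3)) y" "has_partial i (\<lambda>p. \<Theta>' (p $ 3)) y"
    "partial i (\<lambda>p. \<Theta> (p $ 3)) y = (if i = 3 then \<Theta>' (y $ 3) else 0)"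
    "partial i (\<lambda>p. \<Theta>' (p $ 3)) y = (if i = 3 then \<Theta>'' (y $ 3) else 0)"
    by (rule partial_of_nth[OF \<Theta>_deriv[OF s]] partial_of_nth[OF \<Theta>'_deriv[OF s]])+
qed

lemma curvature_chart:
  "y \<in> chart_dom \<Longrightarrow> dir_deriv \<i> f (base_pt y) = lam (base_pt y) + dir_deriv 1 h (base_pt y)"
  using curvature by (simp add: chart_dom_def)

lemmas partial_simps = partial_rules partial_base partial_\<rho> has_partial_\<rho> has_partial_base_vertical

lemma G_nth:
  "G y $ 1 $ 1 = \<rho> y * lam (base_pt y) + \<Theta> (y $ 3) * (f (base_pt y))\<^sup>2"
  "G y $ 2 $ 2 = \<rho> y * lam (base_pt y) + \<Theta> (y $ 3) * (h (base_pt y))\<^sup>2"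
  "G y $ 3 $ 3 = 1 / \<Theta> (y $ 3)"
  "G y $ 4 $ 4 = \<Theta> (y $ 3)"
  "G y $ 1 $ 2 = \<Theta> (y $ 3) * (f (base_pt y) * h (base_pt y))"
  "G y $ 2 $ 1 = \<Theta> (y $ 3) * (f (base_pt y) * h (base_pt y))"
  "G y $ 1 $ 3 = 0" "G y $ 2 $ 3 = 0" "G y $ 3 $ 1 = 0" "G y $ 3 $ 2 = 0"
  "G y $ 3 $ 4 = 0" "G y $ 4 $ 3 = 0"
  "G y $ 1 $ 4 = - \<Theta> (y $ 3) * f (base_pt y)" "G y $ 4 $ 1 = - \<Theta> (y $ 3) * f (base_pt y)"
  "G y $ 2 $ 4 = - \<Theta> (y $ 3) * h (base_pt y)" "G y $ 4 $ 2 = - \<Theta> (y $ 3) * h (base_pt y)"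
  by (simp_all add: G_def tensor_defs power2_eq_square)

lemma Ginv_nth:
  "Ginv y $ 1 $ 1 = 1 / (\<rho> y * lam (base_pt y))"
  "Ginv y $ 2 $ 2 = 1 / (\<rho> y * lam (base_pt y))"
  "Ginv y $ 3 $ 3 = \<Theta> (y $ 3)"
  "Ginv y $ 4 $ 4 = 1 / \<Theta> (y $ 3) + ((f (base_pt y))\<^sup>2 + (h (base_pt y))\<^sup>2) / (\<rho> y * lam (base_pt y))"
  "Ginv y $ 1 $ 2 = 0" "Ginv y $ 2 $ 1 = 0"
  "Ginv y $ 1 $ 3 = 0" "Ginv y $ 2 $ 3 = 0" "Ginv y $ 3 $ 1 = 0" "Ginv y $ 3 $ 2 = 0"
  "Ginv y $ 3 $ 4 = 0" "Ginv y $ 4 $ 3 = 0"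
  "Ginv y $ 1 $ 4 = f (base_pt y) / (\<rho> y * lam (base_pt y))"
  "Ginv y $ 4 $ 1 = f (base_pt y) / (\<rho> y * lam (base_pt y))"
  "Ginv y $ 2 $ 4 = h (base_pt y) / (\<rho> y * lam (base_pt y))"
  "Ginv y $ 4 $ 2 = h (base_pt y) / (\<rho> y * lam (base_pt y))"
  by (simp_all add: Ginv_def e\<^sub>u_def e\<^sub>v_def tensor_defs power2_eq_square add_divide_distrib)

lemma W_nth:
  "W y $ 1 $ 1 = 0" "W y $ 2 $ 2 = 0" "W y $ 3 $ 3 = 0" "W y $ 4 $ 4 = 0"
  "W y $ 1 $ 2 = \<rho> y * lam (base_pt y)" "W y $ 2 $ 1 = - (\<rho> y * lam (base_pt y))"
  "W y $ 1 $ 3 = f (base_pt y)" "W y $ 3 $ 1 = - f (base_pt y)"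
  "W y $ 2 $ 3 = h (base_pt y)" "W y $ 3 $ 2 = - h (base_pt y)"
  "W y $ 3 $ 4 = 1" "W y $ 4 $ 3 = -1"
  "W y $ 1 $ 4 = 0" "W y $ 4 $ 1 = 0" "W y $ 2 $ 4 = 0" "W y $ 4 $ 2 = 0"
  by (simp_all add: W_def wedge_def tensor_defs)

lemma J_nth:
  "J y $ 1 $ 1 = 0" "J y $ 2 $ 1 = 1" "J y $ 3 $ 1 = \<Theta> (y $ 3) * f (base_pt y)" "J y $ 4 $ 1 = h (base_pt y)"
  "J y $ 1 $ 2 = -1" "J y $ 2 $ 2 = 0" "J y $ 3 $ 2 = \<Theta> (y $ 3) * h (base_pt y)" "J y $ 4 $ 2 = - f (base_pt y)"
  "J y $ 1 $ 3 = 0" "J y $ 2 $ 3 = 0" "J y $ 3 $ 3 = 0" "J y $ 4 $ 3 = 1 / \<Theta> (y $ 3)"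
  "J y $ 1 $ 4 = 0" "J y $ 2 $ 4 = 0" "J y $ 3 $ 4 = - \<Theta> (y $ 3)" "J y $ 4 $ 4 = 0"
  by (simp_all add: J_def e\<^sub>u_def e\<^sub>v_def tensor_defs)

lemma Ginv_G: "y \<in> chart_dom \<Longrightarrow> Ginv y ** G y = mat 1"
  using chart_pos[of y]
  by (simp add: vec_eq_iff forall_4 matrix_matrix_mult_def sum_4 mat_def G_nth Ginv_nth field_simps
      power2_eq_square)

lemma matrix_inv_G: "y \<in> chart_dom \<Longrightarrow> matrix_inv (G y) = Ginv y"
  by (intro matrix_inv_eqI) (metis Ginv_G matrix_left_right_inverse)

section \<open>Curvature\<close>

text \<open>The bilinear forms \<open>\<Gamma>\<^sup>k = - \<nabla>dx\<^sup>k\<close>. For \<open>k = u, v, z\<close> this is \<open>-1/2\<close> times the Lie derivative of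
  the metric along the gradient of \<open>x\<^sup>k\<close>, which is \<open>e\<^sub>u\<close> or \<open>e\<^sub>v\<close> divided by \<open>\<rho> lam\<close>, or \<open>\<Theta> \<partial>\<^sub>z\<close>; since
  \<open>d\<theta> = lam du \<and> dv\<close>, the first two contract \<open>d\<theta>\<close> to \<open>dv / \<rho>\<close> and \<open>- du / \<rho>\<close>. For \<open>k = t\<close> one
  differentiates \<open>dt = \<theta> + f du + h dv\<close>.\<close>
definition \<Gamma>u :: "real^4 \<Rightarrow> real^4^4" where
  "\<Gamma>u y =
     (dir_deriv 1 lam (base_pt y) / (2 * lam (base_pt y))) *\<^sub>R (tensor du du - tensor dv dv)
     + (dir_deriv \<i> lam (base_pt y) / (2 * lam (base_pt y))) *\<^sub>R symprod du dv
     + (1 / (2 * \<rho> y)) *\<^sub>R symprod du dz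
     - (\<Theta> (y $ 3) / (2 * \<rho> y)) *\<^sub>R symprod dv (\<theta> y)"

definition \<Gamma>v :: "real^4 \<Rightarrow> real^4^4" where
  "\<Gamma>v y =
     (dir_deriv \<i> lam (base_pt y) / (2 * lam (base_pt y))) *\<^sub>R (tensor dv dv - tensor du du)
     + (dir_deriv 1 lam (base_pt y) / (2 * lam (base_pt y))) *\<^sub>R symprod du dv
     + (1 / (2 * \<rho> y)) *\<^sub>R symprod dv dz
     + (\<Theta> (y $ 3) / (2 * \<rho> y)) *\<^sub>R symprod du (\<theta> y)"

definition \<Gamma>z :: "real^4 \<Rightarrow> real^4^4" where
  "\<Gamma>z y =
     - (\<Theta> (y $ 3) * lam (base_pt y) / 2) *\<^sub>R (tensor du du + tensor dv dv)
     - (\<Theta>' (y $ 3) / (2 * \<Theta> (y $ 3))) *\<^sub>R tensor dz dz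
     - (\<Theta> (y $ 3) * \<Theta>' (y $ 3) / 2) *\<^sub>R tensor (\<theta> y) (\<theta> y)"

definition \<Gamma>t :: "real^4 \<Rightarrow> real^4^4" where
  "\<Gamma>t y =
     f (base_pt y) *\<^sub>R \<Gamma>u y + h (base_pt y) *\<^sub>R \<Gamma>v y
     + (\<Theta>' (y $ 3) / (2 * \<Theta> (y $ 3))) *\<^sub>R symprod (\<theta> y) dz
     - dir_deriv 1 f (base_pt y) *\<^sub>R tensor du du - dir_deriv \<i> h (base_pt y) *\<^sub>R tensor dv dv
     - ((dir_deriv \<i> f (base_pt y) + dir_deriv 1 h (base_pt y)) / 2) *\<^sub>R symprod du dv"

definition \<Gamma> :: "4 \<Rightarrow> real^4 \<Rightarrow> real^4^4" where
  "\<Gamma> k y = (if k = 1 then \<Gamma>u y else if k = 2 then \<Gamma>v y else if k = 3 then \<Gamma>z y else \<Gamma>t y)"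

lemmas \<Gamma>_defs = \<Gamma>_def \<Gamma>u_def \<Gamma>v_def \<Gamma>z_def \<Gamma>t_def

text \<open>Lowering the upper index turns the claim about the Christoffel symbols into identities without
  the inverse of the metric, one for each triple of indices.\<close>
lemma christoffel_lower:
  assumes "y \<in> chart_dom"
  shows "partial i (\<lambda>p. G p $ j $ l) y + partial j (\<lambda>p. G p $ i $ l) y - partial l (\<lambda>p. G p $ i $ j) y
    = 2 * (\<Sum>k\<in>UNIV. G y $ l $ k * \<Gamma> k y $ i $ j)"
proof -
  have "\<forall>i j l. partial i (\<lambda>p. G p $ j $ l) y + partial j (\<lambda>p. G p $ i $ l) y
      - partial l (\<lambda>p. G p $ i $ j) y = 2 * (\<Sum>k\<in>UNIV. G y $ l $ k * \<Gamma> k y $ i $ j)"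
    \<comment> \<open>Differentiate, insert the closed forms, and only then clear denominators: multiplying out
      under the derivatives would destroy the nonzero factors that the quotient rule asks for.\<close>
    by (simp only: forall_4, intro conjI)
      (simp_all add: G_nth power2_eq_square partial_simps partial_data[OF assms] chart_nonzero[OF assms],
       simp_all add: sum_4 G_nth \<Gamma>_defs tensor_defs curvature_chart[OF assms] chart_nonzero[OF assms],
       insert chart_pos[OF assms], simp_all add: field_simps power2_eq_square)
  then show ?thesis by blast
qed

lemma christoffel_G:
  assumes "y \<in> chart_dom"
  shows "christoffel G k i j y = \<Gamma> k y $ i $ j"
proof -
  have inv: "(\<Sum>l\<in>UNIV. Ginv y $ k $ l * G y $ l $ m) = (if k = m then 1 else 0)" for m
    using Ginv_G[OF assms] by (simp add: vec_eq_iff matrix_matrix_mult_def mat_def)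
  have "christoffel G k i j y = (\<Sum>l\<in>UNIV. \<Sum>m\<in>UNIV. Ginv y $ k $ l * (G y $ l $ m * \<Gamma> m y $ i $ j))"
    unfolding christoffel_def christoffel_lower[OF assms] matrix_inv_G[OF assms]
    by (simp add: sum_distrib_left sum_divide_distrib)
  also have "\<dots> = (\<Sum>m\<in>UNIV. (\<Sum>l\<in>UNIV. Ginv y $ k $ l * G y $ l $ m) * \<Gamma> m y $ i $ j)"
    by (subst sum.swap) (simp add: sum_distrib_right mult.assoc)
  also have "\<dots> = \<Gamma> k y $ i $ j"
    by (simp add: inv if_distrib[of "\<lambda>t. t * _"] cong: if_cong)
  finally show ?thesis .
qed

lemma ricci_\<Gamma>:
  assumes "y \<in> chart_dom"
  shows "ricci G i j y = (\<Sum>k\<in>UNIV. partial k (\<lambda>p. \<Gamma> k p $ i $ j) y - partial j (\<lambda>p. \<Gamma> k p $ i $ k) y) +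
     (\<Sum>k\<in>UNIV. \<Sum>l\<in>UNIV. \<Gamma> k y $ k $ l * \<Gamma> l y $ i $ j - \<Gamma> k y $ j $ l * \<Gamma> l y $ i $ k)"
  unfolding ricci_def christoffel_G[OF assms]
  by (intro arg_cong2[of _ _ _ _ "(+)"] sum.cong arg_cong2[of _ _ _ _ "(-)"] refl
       partial_cong[OF open_chart_dom assms] christoffel_G)

definition ric_horizontal :: "real^4 \<Rightarrow> real" where
  "ric_horizontal y =
     (conformal_curvature lam (base_pt y) - \<Theta>' (y $ 3) - \<Theta> (y $ 3) / \<rho> y) * lam (base_pt y) / 2"

definition ric_fibre :: "real^4 \<Rightarrow> real" where
  "ric_fibre y = - (\<Theta>'' (y $ 3) + \<Theta>' (y $ 3) / \<rho> y - \<Theta> (y $ 3) / (\<rho> y)\<^sup>2) * \<Theta> (y $ 3) / 2"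

text \<open>The Ricci tensor is \<open>ric_horizontal (du\<^sup>2 + dv\<^sup>2) + ric_fibre (dz\<^sup>2 / \<Theta>\<^sup>2 + \<theta>\<^sup>2)\<close>. Listed are
  the components that meet a nonzero entry of the inverse metric in the scalar curvature.\<close>
lemma ricci_G:
  assumes "y \<in> chart_dom"
  shows "ricci G 1 1 y = ric_horizontal y + (f (base_pt y))\<^sup>2 * ric_fibre y"
    and "ricci G 2 2 y = ric_horizontal y + (h (base_pt y))\<^sup>2 * ric_fibre y"
    and "ricci G 3 3 y = ric_fibre y / (\<Theta> (y $ 3))\<^sup>2"
    and "ricci G 4 4 y = ric_fibre y"
    and "ricci G 1 4 y = - f (base_pt y) * ric_fibre y"
    and "ricci G 4 1 y = - f (base_pt y) * ric_fibre y"
    and "ricci G 2 4 y = - h (base_pt y) * ric_fibre y"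
    and "ricci G 4 2 y = - h (base_pt y) * ric_fibre y"
  unfolding ricci_\<Gamma>[OF assms] ric_horizontal_def ric_fibre_def
  by (simp_all add: sum_4 \<Gamma>_defs tensor_defs,
      simp_all add: partial_simps partial_data[OF assms] chart_nonzero[OF assms]
        curvature_chart[OF assms],
      insert chart_pos[OF assms],
      simp_all add: field_simps power2_eq_square conformal_curvature_def)

text \<open>With \<open>F = \<rho> \<Theta>\<close> the last two terms are \<open>- F'' / \<rho>\<close>.\<close>
lemma scalar_curvature_G:
  assumes "y \<in> chart_dom"
  shows "scalar_curvature G y =
    conformal_curvature lam (base_pt y) / \<rho> y - \<Theta>'' (y $ 3) - 2 * \<Theta>' (y $ 3) / \<rho> y"
  unfolding scalar_curvature_def matrix_inv_G[OF assms] sum_4 Ginv_nth ricci_G[OF assms]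
    ric_horizontal_def ric_fibre_def
  using chart_pos[OF assms] by (simp add: field_simps power2_eq_square)

section \<open>The Kaehler structure and the extremality condition\<close>

lemma complex_structure_G:
  assumes "y \<in> chart_dom"
  shows "complex_structure G W y = J y"
  unfolding complex_structure_def matrix_inv_G[OF assms]
  using chart_pos[OF assms]
  by (simp add: vec_eq_iff forall_4 matrix_matrix_mult_def sum_4 transpose_def
      Ginv_nth W_nth J_nth field_simps power2_eq_square)

lemma J_squared:
  assumes "y \<in> chart_dom"
  shows "J y ** J y = - mat 1"
  using chart_pos[OF assms]
  by (simp add: vec_eq_iff forall_4 matrix_matrix_mult_def sum_4 mat_def J_nth field_simps)

lemma G_symmetric: "transpose (G y) = G y"
  by (simp add: vec_eq_iff forall_4 transpose_def G_nth)

lemma W_skew: "transpose (W y) = - W y"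
  by (simp add: vec_eq_iff forall_4 transpose_def W_nth)

lemma G_pos:
  assumes "y \<in> chart_dom" "v \<noteq> 0"
  shows "v \<bullet> (G y *v v) > 0"
proof -
  have eq: "v \<bullet> (G y *v v) = \<rho> y * lam (base_pt y) * ((v $ 1)\<^sup>2 + (v $ 2)\<^sup>2) + (v $ 3)\<^sup>2 / \<Theta> (y $ 3)
      + \<Theta> (y $ 3) * (v \<bullet> \<theta> y)\<^sup>2"
    by (simp add: inner_vec_def matrix_vector_mult_def sum_4 G_nth tensor_defs)
      (simp add: algebra_simps power2_eq_square)
  note pos = chart_pos[OF assms(1)]
  have nonneg: "0 \<le> \<rho> y * lam (base_pt y) * ((v $ 1)\<^sup>2 + (v $ 2)\<^sup>2)"
      "0 \<le> (v $ 3)\<^sup>2 / \<Theta> (y $ 3)" "0 \<le> \<Theta> (y $ 3) * (v \<bullet> \<theta> y)\<^sup>2"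
    using pos by simp_all
  show ?thesis
  proof (rule ccontr)
    assume "\<not> ?thesis"
    then have "\<rho> y * lam (base_pt y) * ((v $ 1)\<^sup>2 + (v $ 2)\<^sup>2) = 0"
      "(v $ 3)\<^sup>2 / \<Theta> (y $ 3) = 0" "\<Theta> (y $ 3) * (v \<bullet> \<theta> y)\<^sup>2 = 0"
      using nonneg eq by linarith+
    then have "v $ 1 = 0" "v $ 2 = 0" "v $ 3 = 0" "v \<bullet> \<theta> y = 0"
      using pos by (simp_all add: sum_power2_eq_zero_iff)
    then have "v $ 4 = 0"
      by (simp add: inner_vec_def sum_4 tensor_defs)
    with \<open>v $ 1 = 0\<close> \<open>v $ 2 = 0\<close> \<open>v $ 3 = 0\<close> have "v = 0"
      by (simp add: vec_eq_iff forall_4)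
    with assms(2) show False by simp
  qed
qed

text \<open>The differential of \<open>\<rho> lam du \<and> dv\<close> is \<open>lam dz \<and> du \<and> dv\<close>, and it cancels
  \<open>d(dz \<and> \<theta>) = - dz \<and> d\<theta>\<close>.\<close>
lemma W_closed:
  assumes "y \<in> chart_dom"
  shows "partial i (\<lambda>p. W p $ j $ k) y + partial j (\<lambda>p. W p $ k $ i) y + partial k (\<lambda>p. W p $ i $ j) y = 0"
proof -
  have "\<forall>i j k. partial i (\<lambda>p. W p $ j $ k) y + partial j (\<lambda>p. W p $ k $ i) y
      + partial k (\<lambda>p. W p $ i $ j) y = 0"
    by (simp only: forall_4, intro conjI)
      (simp_all add: W_nth partial_simps partial_data[OF assms] curvature_chart[OF assms])
  then show ?thesis by blast
qed

text \<open>Since \<open>J\<close> sends \<open>e\<^sub>u\<close> to \<open>e\<^sub>v\<close> and \<open>\<partial>\<^sub>z\<close> to \<open>\<partial>\<^sub>t / \<Theta>\<close>, and the Nijenhuis tensor vanishes on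
  pairs \<open>X, J X\<close>, it is enough that \<open>e\<^sub>u\<close> and \<open>e\<^sub>v\<close> commute with \<open>\<partial>\<^sub>z\<close> and \<open>\<partial>\<^sub>t / \<Theta>\<close>. The coordinate
  computation confirms this for all components.\<close>
lemma nijenhuis_J:
  assumes "y \<in> chart_dom"
  shows "nijenhuis (complex_structure G W) k i j y = 0"
proof -
  have eq: "nijenhuis (complex_structure G W) k i j y = nijenhuis J k i j y" for k i j
    unfolding nijenhuis_def complex_structure_G[OF assms]
    by (intro sum.cong arg_cong2[of _ _ _ _ "(*)"] refl arg_cong2[of _ _ _ _ "(-)"]
       partial_cong[OF open_chart_dom assms]) (simp_all add: complex_structure_G)
  have "\<forall>k i j. nijenhuis J k i j y = 0"
    by (simp only: forall_4, intro conjI)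
      (simp_all add: nijenhuis_def sum_4 J_nth partial_simps partial_data[OF assms]
         chart_nonzero[OF assms],
       insert chart_pos[OF assms], simp_all add: field_simps power2_eq_square)
  then show ?thesis using eq by simp
qed

lemma kaehler_G: "y \<in> chart_dom \<Longrightarrow> kaehler_at G W y"
  unfolding kaehler_at_def
  by (simp add: G_symmetric W_skew G_pos W_closed nijenhuis_J complex_structure_G J_squared)

text \<open>The gradient of an affine function of \<open>z\<close> is a multiple of \<open>grad z = \<Theta> \<partial>\<^sub>z = - J \<partial>\<^sub>t\<close>; this
  field commutes with \<open>e\<^sub>u\<close>, \<open>e\<^sub>v\<close>, \<open>\<partial>\<^sub>t\<close> and itself, hence preserves \<open>J\<close>.\<close>
lemma extremal_G:
  assumes scal: "\<And>y. y \<in> chart_dom \<Longrightarrow> scalar_curvature G y = A * y $ 3 + B" and y: "y \<in> chart_dom"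
  shows "extremal_at G W y"
proof -
  have grad: "gradient G (scalar_curvature G) p = (A * \<Theta> (p $ 3)) *\<^sub>R axis 3 1"
    if "p \<in> chart_dom" for p
  proof -
    have "partial i (scalar_curvature G) p = partial i (\<lambda>y. A * y $ 3 + B) p" for i
      by (rule partial_cong[OF open_chart_dom that scal])
    then have "partial i (scalar_curvature G) p = (if i = 3 then A else 0)" for i
      by (simp add: partial_simps partial_nth has_partial_nth)
    then show ?thesis
      unfolding gradient_def matrix_inv_G[OF that]
      by (simp add: vec_eq_iff forall_4 matrix_vector_mult_def sum_4 Ginv_nth axis_def)
  qed
  have "lie_deriv_endo (gradient G (scalar_curvature G)) (complex_structure G W) i j y
     = lie_deriv_endo (\<lambda>p. (A * \<Theta> (p $ 3)) *\<^sub>R axis 3 1) J i j y" for i j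
    unfolding lie_deriv_endo_def complex_structure_G[OF y] grad[OF y]
    by (intro sum.cong arg_cong2[of _ _ _ _ "(*)"] refl arg_cong2[of _ _ _ _ "(-)"]
        arg_cong2[of _ _ _ _ "(+)"] partial_cong[OF open_chart_dom y])
      (simp_all add: complex_structure_G grad)
  moreover have "\<forall>i j. lie_deriv_endo (\<lambda>p. (A * \<Theta> (p $ 3)) *\<^sub>R axis 3 1) J i j y = 0"
    by (simp only: forall_4, intro conjI)
      (simp_all add: lie_deriv_endo_def axis_def sum_4 J_nth partial_simps partial_data[OF y]
         chart_nonzero[OF y],
       insert chart_pos[OF y], simp_all add: field_simps power2_eq_square)
  ultimately show ?thesis
    by (simp add: extremal_at_def)
qed

end

section \<open>The momentum profile\<close>

text \<open>The functions \<open>q / (s + a)\<^sup>n\<close> with a polynomial \<open>q\<close> are closed under differentiation, which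
  gives all derivatives at once.\<close>
lemma smooth_on_Icc_poly_divide:
  assumes a: "\<And>s. s \<in> {l..r} \<Longrightarrow> s + a \<noteq> 0"
  shows "smooth_on_Icc (\<lambda>s. poly p s / (s + a)) l r"
proof -
  define q where "q = rec_nat p (\<lambda>n q. pderiv q * [:a, 1:] - Polynomial.smult (real (Suc n)) q)"
  define d where "d n s = poly (q n) s / (s + a) ^ Suc n" for n s
  have q0: "q 0 = p" and qS: "q (Suc n) = pderiv (q n) * [:a, 1:] - Polynomial.smult (real (Suc n)) (q n)" for n
    by (simp_all add: q_def)
  have "(d n has_real_derivative d (Suc n) s) (at s within {l..r})" if "s \<in> {l..r}" for n s
  proof -
    have quotient: "(A * w ^ Suc n - B * (real (Suc n) * w ^ n)) / (w ^ Suc n * w ^ Suc n)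
      = (A * w - real (Suc n) * B) / w ^ Suc (Suc n)" if "w \<noteq> 0" for A B w :: real
      using that by (simp add: field_simps)
    have "(d n has_real_derivative (poly (pderiv (q n)) s * (s + a) ^ Suc n
        - poly (q n) s * (real (Suc n) * (s + a) ^ n)) / ((s + a) ^ Suc n * (s + a) ^ Suc n)) (at s)"
      unfolding d_def using a[OF that]
      by (intro DERIV_divide poly_DERIV) (auto intro!: derivative_eq_intros simp del: power_Suc)
    moreover have "d (Suc n) s
      = (poly (pderiv (q n)) s * (s + a) - real (Suc n) * poly (q n) s) / (s + a) ^ Suc (Suc n)"
      by (simp add: d_def qS algebra_simps del: power_Suc)
    ultimately show ?thesis
      unfolding quotient[OF a[OF that]] by (simp add: has_field_derivative_at_within)
  qed
  moreover have "d 0 = (\<lambda>s. poly p s / (s + a))"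
    by (simp add: fun_eq_iff d_def q0)
  ultimately show ?thesis
    unfolding smooth_on_Icc_def by blast
qed

text \<open>The quotient \<open>F / (s + a)\<close> for \<open>F = \<kappa> (1 - s\<^sup>2) (s + a + C (1 - s\<^sup>2))\<close>. Every polynomial of degree
  at most four with \<open>F(\<plusminus>1) = 0\<close> and \<open>F'(\<plusminus>1) = \<minusplus> 2 \<kappa> (a \<plusminus> 1)\<close> is of this form.\<close>
definition extremal_profile :: "real \<Rightarrow> real \<Rightarrow> real \<Rightarrow> real \<Rightarrow> real" where
  "extremal_profile \<kappa> a C s = \<kappa> * (1 - s\<^sup>2) * (s + a + C * (1 - s\<^sup>2)) / (s + a)"

text \<open>The first two derivatives, in the form \<open>\<Theta>' = (F' - \<Theta>) / (s + a)\<close> and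
  \<open>\<Theta>'' = (F'' - 2 \<Theta>') / (s + a)\<close> in which the curvature formula uses them.\<close>
definition extremal_profile' :: "real \<Rightarrow> real \<Rightarrow> real \<Rightarrow> real \<Rightarrow> real" where
  "extremal_profile' \<kappa> a C s =
    (\<kappa> * (- 2 * s * (s + a + C * (1 - s\<^sup>2)) + (1 - s\<^sup>2) * (1 - 2 * C * s)) - extremal_profile \<kappa> a C s) / (s + a)"

definition extremal_profile'' :: "real \<Rightarrow> real \<Rightarrow> real \<Rightarrow> real \<Rightarrow> real" where
  "extremal_profile'' \<kappa> a C s =
    (\<kappa> * (12 * C * s\<^sup>2 - 6 * s - 2 * a - 4 * C) - 2 * extremal_profile' \<kappa> a C s) / (s + a)"

lemma DERIV_divide_shift:
  assumes F: "(F has_real_derivative F') (at s)" and nz: "s + a \<noteq> 0"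
  shows "((\<lambda>s. F s / (s + a)) has_real_derivative (F' - F s / (s + a)) / (s + a)) (at s)"
proof -
  have "((\<lambda>s. F s / (s + a)) has_real_derivative (F' * (s + a) - F s * 1) / ((s + a) * (s + a))) (at s)"
    by (rule DERIV_divide[where g = "\<lambda>s. s + a"]) (auto intro!: derivative_eq_intros F nz)
  moreover have "(F' * w - F s * 1) / (w * w) = (F' - F s / w) / w" if "w \<noteq> 0" for w
    using that by (simp add: field_simps)
  ultimately show ?thesis
    using nz by metis
qed

lemma extremal_profile_deriv:
  assumes "s + a \<noteq> 0"
  shows "(extremal_profile \<kappa> a C has_real_derivative extremal_profile' \<kappa> a C s) (at s)"
  unfolding extremal_profile'_def extremal_profile_def [abs_def]
  by (rule DERIV_divide_shift[OF _ assms])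
    (auto intro!: derivative_eq_intros simp: algebra_simps power2_eq_square)

lemma extremal_profile'_deriv:
  assumes "s + a \<noteq> 0"
  shows "(extremal_profile' \<kappa> a C has_real_derivative extremal_profile'' \<kappa> a C s) (at s)"
proof -
  have "((\<lambda>s. \<kappa> * (- 2 * s * (s + a + C * (1 - s\<^sup>2)) + (1 - s\<^sup>2) * (1 - 2 * C * s)) - extremal_profile \<kappa> a C s)
    has_real_derivative \<kappa> * (12 * C * s\<^sup>2 - 6 * s - 2 * a - 4 * C) - extremal_profile' \<kappa> a C s) (at s)"
    by (rule DERIV_diff[OF _ extremal_profile_deriv[OF assms]])
      (auto intro!: derivative_eq_intros simp: algebra_simps power2_eq_square)
  from DERIV_divide_shift[OF this assms] show ?thesis
    unfolding extremal_profile''_def extremal_profile'_def [abs_def] by (simp add: diff_diff_eq)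
qed

text \<open>The factor \<open>s + a + C (1 - s\<^sup>2)\<close> increases with \<open>C\<close>, and for \<open>C = - 1/2\<close> completing the square
  turns it into \<open>(a - 1) + (1 + s)\<^sup>2 / 2\<close>.\<close>
lemma profiles_extremal_profile:
  assumes a: "a > 1" and \<kappa>: "\<kappa> > 0" and C: "C \<ge> - 1/2"
  shows "extremal_profile \<kappa> a C \<in> profiles \<kappa>"
proof -
  have nz: "s + a > 0" if "s \<in> {-1..1}" for s
    using a that by simp
  have "extremal_profile \<kappa> a C = (\<lambda>s. poly (Polynomial.smult \<kappa> ([:1,0,-1:] * ([:a, 1:] + Polynomial.smult C [:1,0,-1:]))) s / (s + a))"
    by (auto simp: fun_eq_iff extremal_profile_def power2_eq_square algebra_simps)
  then have "smooth_on_Icc (extremal_profile \<kappa> a C) (-1) 1"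
    by (metis smooth_on_Icc_poly_divide nz less_irrefl)
  moreover have "extremal_profile \<kappa> a C s > 0" if s: "s \<in> {-1<..<1}" for s
  proof -
    have s2: "s\<^sup>2 < 1"
      using s by (auto simp: abs_square_less_1)
    have "0 < (a - 1) + (1 + s)\<^sup>2 / 2"
      using a by (intro add_pos_nonneg) auto
    also have "\<dots> = s + a + (- 1/2) * (1 - s\<^sup>2)"
      by (simp add: power2_eq_square field_simps)
    also have "\<dots> \<le> s + a + C * (1 - s\<^sup>2)"
      using C s2 by (intro add_left_mono mult_right_mono) auto
    finally show ?thesis
      unfolding extremal_profile_def using nz[of s] s s2 \<kappa> by (intro divide_pos_pos mult_pos_pos) auto
  qed
  moreover have "extremal_profile' \<kappa> a C (-1) = 2 * \<kappa>" "extremal_profile' \<kappa> a C 1 = - 2 * \<kappa>"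
    using a by (simp_all add: extremal_profile'_def extremal_profile_def field_simps)
  ultimately show ?thesis
    using extremal_profile_deriv[of "-1" a \<kappa> C] extremal_profile_deriv[of 1 a \<kappa> C] a
    by (auto simp: profiles_def extremal_profile_def intro: has_field_derivative_at_within)
qed

text \<open>The condition on \<open>r\<close> says \<open>F''(- a) = r\<close>, so that \<open>s + a\<close> divides the quadratic polynomial
  \<open>r - F''\<close>.\<close>
lemma extremal_profile_scalar_curvature:
  assumes nz: "s + a \<noteq> 0" and r: "r = \<kappa> * (C * (12 * a\<^sup>2 - 4) + 4 * a)"
  shows "r / (s + a) - extremal_profile'' \<kappa> a C s - 2 * extremal_profile' \<kappa> a C s / (s + a)
    = - 12 * \<kappa> * C * s + \<kappa> * (12 * C * a + 6)"
proof -
  have "r / (s + a) - extremal_profile'' \<kappa> a C s - 2 * extremal_profile' \<kappa> a C s / (s + a) =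
    (r - \<kappa> * (12 * C * s\<^sup>2 - 6 * s - 2 * a - 4 * C)) / (s + a)"
    by (simp add: extremal_profile''_def diff_divide_distrib)
  also have "r - \<kappa> * (12 * C * s\<^sup>2 - 6 * s - 2 * a - 4 * C) = (- 12 * \<kappa> * C * s + \<kappa> * (12 * C * a + 6)) * (s + a)"
    unfolding r by (simp add: algebra_simps power2_eq_square)
  finally show ?thesis using nz by simp
qed

text \<open>Solving for \<open>C\<close>, the bound \<open>C \<ge> - 1/2\<close> reads \<open>r / \<kappa> \<ge> - 2 (3 a + 1) (a - 1)\<close>, so any large
  \<open>\<kappa>\<close> will do.\<close>
lemma exists_profile_parameters:
  fixes a r :: real
  assumes a: "a > 1"
  shows "\<exists>\<kappa>>0. \<exists>C\<ge>-1/2. r = \<kappa> * (C * (12 * a\<^sup>2 - 4) + 4 * a)"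
proof -
  define d where "d = 2 * (3 * a + 1) * (a - 1)"
  define \<kappa> where "\<kappa> = (\<bar>r\<bar> + 1) / d"
  define C where "C = (r / \<kappa> - 4 * a) / (12 * a\<^sup>2 - 4)"
  have d: "d > 0"
    using a by (simp add: d_def)
  then have \<kappa>: "\<kappa> > 0"
    unfolding \<kappa>_def by (intro divide_pos_pos) auto
  have a2: "12 * a\<^sup>2 - 4 > 0"
    using one_less_power[OF a, of 2] by simp
  have "- r \<le> \<kappa> * d"
    using d by (simp add: \<kappa>_def)
  then have "r / \<kappa> \<ge> - d"
    using \<kappa> by (simp add: field_simps)
  then have "C \<ge> -1/2"
    unfolding C_def using a2 by (simp add: pos_le_divide_eq d_def algebra_simps power2_eq_square)
  moreover have "r = \<kappa> * (C * (12 * a\<^sup>2 - 4) + 4 * a)"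
    using \<kappa> a2 by (simp add: C_def)
  ultimately show ?thesis using \<kappa> by blast
qed

section \<open>Admissible metrics on the ruled surface\<close>

lemma open_joint_dom:
  assumes "riemann_surface S" "holomorphic_line_bundle S L" "c \<in> surf_atlas S" "u \<in> bun_trivs L"
  shows "open (joint_dom c u)"
proof -
  have c: "open (snd c ` fst c)" "openin (surf_top S) (fst c)"
      "homeomorphic_map (subtopology (surf_top S) (fst c)) (top_of_set (snd c ` fst c)) (snd c)"
    using assms(1,3) by (auto simp: riemann_surface_def)
  have "openin (surf_top S) (fst u)"
    using assms(2,4) by (auto simp: holomorphic_line_bundle_def)
  then have "openin (subtopology (surf_top S) (fst c)) (fst c \<inter> fst u)"
    by (auto simp: openin_subtopology)
  then have "openin (top_of_set (snd c ` fst c)) (snd c ` (fst c \<inter> fst u))"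
    using homeomorphic_imp_open_map[OF c(3)] by (simp add: open_map_def)
  then show ?thesis
    using c(1) by (simp add: joint_dom_def openin_open_eq)
qed

lemma conformal_chart_surface:
  assumes metric: "surface_metric S lam" and c: "c \<in> surf_atlas S"
    and D: "open D" "D \<subseteq> snd c ` fst c" and S: "riemann_surface S"
  shows "conformal_chart D (lam c)"
proof -
  have "open (snd c ` fst c)" "smooth_on (lam c) (snd c ` fst c)"
      "\<And>w. w \<in> snd c ` fst c \<Longrightarrow> lam c w > 0"
    using S metric c by (auto simp: riemann_surface_def surface_metric_def)
  then show ?thesis
    using D by unfold_locales (auto simp: Basis_complex_def smooth_onD smooth_on_dir_deriv subset_iff)
qed

lemma calabi_chart_extremal_profile:
  assumes S: "riemann_surface S" and L: "holomorphic_line_bundle S L"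
    and lam: "surface_metric S lam"
    and \<alpha>: "unitary_connection S L \<alpha>" "curvature_form_eq S L \<alpha> lam"
    and c: "c \<in> surf_atlas S" and u: "u \<in> bun_trivs L"
    and a: "a > 1" and profile: "extremal_profile \<kappa> a C \<in> profiles \<kappa>"
  shows "calabi_chart (joint_dom c u) (lam c) (\<lambda>w. Re (\<alpha> c u w)) (\<lambda>w. Im (\<alpha> c u w)) a
    (extremal_profile \<kappa> a C) (extremal_profile' \<kappa> a C) (extremal_profile'' \<kappa> a C)"
proof -
  note D = open_joint_dom[OF S L c u]
  have "joint_dom c u \<subseteq> snd c ` fst c"
    by (auto simp: joint_dom_def)
  then interpret conformal_chart "joint_dom c u" "lam c"
    by (rule conformal_chart_surface[OF lam c D _ S])
  have \<alpha>_diff: "\<alpha> c u differentiable (at w)" if "w \<in> joint_dom c u" for w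
    using \<alpha>(1) c u smooth_onD[OF _ D that] by (auto simp: unitary_connection_def)
  show ?thesis
  proof
    fix w assume w: "w \<in> joint_dom c u"
    obtain A where A: "(\<alpha> c u has_derivative A) (at w)"
      using \<alpha>_diff[OF w] by (auto simp: differentiable_def)
    then show "(\<lambda>w. Re (\<alpha> c u w)) differentiable (at w)" "(\<lambda>w. Im (\<alpha> c u w)) differentiable (at w)"
      using has_derivative_Re[OF A] has_derivative_Im[OF A] unfolding differentiable_def by blast+
    have "- ext_deriv (\<alpha> c u) w = lam c w"
      using \<alpha>(2) c u w by (auto simp: curvature_form_eq_def)
    then show "dir_deriv \<i> (\<lambda>w. Re (\<alpha> c u w)) w = lam c w + dir_deriv 1 (\<lambda>w. Im (\<alpha> c u w)) w"
      by (simp add: ext_deriv_def)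
  next
    fix s :: real assume s: "s \<in> {-1<..<1}"
    then show "extremal_profile \<kappa> a C s > 0"
      using profile by (auto simp: profiles_def)
    have "s + a \<noteq> 0" using s a by auto
    then show "(extremal_profile \<kappa> a C has_real_derivative extremal_profile' \<kappa> a C s) (at s)"
      "(extremal_profile' \<kappa> a C has_real_derivative extremal_profile'' \<kappa> a C s) (at s)"
      by (rule extremal_profile_deriv extremal_profile'_deriv)+
  qed (rule a)
qed

lemma constant_curvature_conformal:
  assumes "riemann_surface S" "constant_curvature_metric S lam"
  obtains r where "\<And>c w. c \<in> surf_atlas S \<Longrightarrow> w \<in> snd c ` fst c \<Longrightarrow> conformal_curvature (lam c) w = r"
proof -
  obtain r where r: "\<And>c y. c \<in> surf_atlas S \<Longrightarrow> Complex (y $ 1) (y $ 2) \<in> snd c ` fst c \<Longrightarrow>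
      scalar_curvature (\<lambda>p::real^2. lam c (Complex (p $ 1) (p $ 2)) *\<^sub>R mat 1) y = r"
    using assms(2) by (auto simp: constant_curvature_metric_def)
  have "conformal_curvature (lam c) w = r" if c: "c \<in> surf_atlas S" and w: "w \<in> snd c ` fst c" for c w
  proof -
    have "open (snd c ` fst c)"
      using assms(1) c by (auto simp: riemann_surface_def)
    then interpret conformal_chart "snd c ` fst c" "lam c"
      using assms c by (auto intro: conformal_chart_surface simp: constant_curvature_metric_def)
    let ?y = "vector [Re w, Im w] :: real^2"
    have "pt ?y = w" by (simp add: pt_def)
    then show ?thesis
      using r[OF c, of ?y] w scalar_curvature_conformal[of ?y]
      by (simp add: plane_dom_def g_def[abs_def] pt_def)
  qed
  then show ?thesis by (rule that)
qed

theorem corollary1p2: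
  fixes S :: "'s surface" and L :: "('s, 'e) line_bundle" and genus :: nat
    and lam :: "'s chart \<Rightarrow> complex \<Rightarrow> real"
    and \<alpha> :: "'s chart \<Rightarrow> ('s, 'e) triv \<Rightarrow> complex \<Rightarrow> complex"
    and z :: "(complex \<times> 'e) set \<Rightarrow> real"
  assumes "compact_riemann_surface S"
    and "has_genus S genus" and "genus > 1"
    and "constant_curvature_metric S lam"
    and "holomorphic_line_bundle S L"
    and "represents_c1 S L (\<lambda>c w. lam c w / (2 * pi))"
    and "morse_bott_function S L z"
    and "unitary_connection S L \<alpha>" and "curvature_form_eq S L \<alpha> lam"
  shows "\<forall>x\<in>{0<..<1}. \<exists>\<kappa>>0. \<exists>(g, \<omega>)\<in>conical_class lam \<alpha> x \<kappa>. extremal_kaehler S L z g \<omega>"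
proof
  fix x :: real assume x: "x \<in> {0<..<1}"
  define a where "a = 1 / x"
  have a: "a > 1" using x by (simp add: a_def)
  have S: "riemann_surface S"
    using assms(1) by (simp add: compact_riemann_surface_def)
  have lam: "surface_metric S lam"
    using assms(4) by (simp add: constant_curvature_metric_def)
  obtain r where r: "\<And>c w. c \<in> surf_atlas S \<Longrightarrow> w \<in> snd c ` fst c \<Longrightarrow> conformal_curvature (lam c) w = r"
    using constant_curvature_conformal[OF S assms(4)] by blast
  obtain \<kappa> C where \<kappa>: "\<kappa> > 0" and C: "C \<ge> - 1/2" and rC: "r = \<kappa> * (C * (12 * a\<^sup>2 - 4) + 4 * a)"
    using exists_profile_parameters[OF a] by blast
  define \<Theta> where "\<Theta> = extremal_profile \<kappa> a C"
  have profile: "\<Theta> \<in> profiles \<kappa>"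
    unfolding \<Theta>_def by (rule profiles_extremal_profile[OF a \<kappa> C])
  have "extremal_kaehler S L z (admissible_metric lam \<alpha> x \<Theta>) (admissible_form lam \<alpha> x)"
    unfolding extremal_kaehler_def
  proof (intro ballI allI impI)
    fix c u m y
    assume c: "c \<in> surf_atlas S" and u: "u \<in> bun_trivs L" and m: "m \<in> regular_part L z"
      and y: "regular_coords L z c u m y"
    interpret chart: calabi_chart "joint_dom c u" "lam c" "\<lambda>w. Re (\<alpha> c u w)" "\<lambda>w. Im (\<alpha> c u w)" a
      \<Theta> "extremal_profile' \<kappa> a C" "extremal_profile'' \<kappa> a C"
      using calabi_chart_extremal_profile[OF S assms(5) lam assms(8,9) c u a] profile
      by (simp add: \<Theta>_def)
    have \<rho>: "(1 + x * p $ 3) / x = chart.\<rho> p" for p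
      unfolding chart.\<rho>_def using x by (simp add: a_def field_simps)
    have metric: "admissible_metric lam \<alpha> x \<Theta> c u = chart.G"
      by (simp add: fun_eq_iff Let_def admissible_metric_def chart.G_def chart.\<theta>_def connection_form_def \<rho>)
    have form: "admissible_form lam \<alpha> x c u = chart.W"
      by (simp add: fun_eq_iff admissible_form_def chart.W_def chart.\<theta>_def connection_form_def \<rho>)
    have dom: "y \<in> chart.chart_dom"
      unfolding chart.chart_dom_def using y m
      by (auto simp: regular_coords_def regular_part_def base_pt_def joint_dom_def)
    have "scalar_curvature chart.G p = - 12 * \<kappa> * C * p $ 3 + \<kappa> * (12 * C * a + 6)"
      if p: "p \<in> chart.chart_dom" for p
    proof -
      have "conformal_curvature (lam c) (base_pt p) = r"
        using p[unfolded chart.chart_dom_def] r[OF c] by (auto simp: joint_dom_def)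
      then show ?thesis
        using extremal_profile_scalar_curvature[OF _ rC, of "p $ 3"] chart.chart_pos(2)[OF p]
        by (simp add: chart.scalar_curvature_G[OF p] chart.\<rho>_def)
    qed
    then show "kaehler_at (admissible_metric lam \<alpha> x \<Theta> c u) (admissible_form lam \<alpha> x c u) y \<and>
        extremal_at (admissible_metric lam \<alpha> x \<Theta> c u) (admissible_form lam \<alpha> x c u) y"
      unfolding metric form using chart.kaehler_G[OF dom] chart.extremal_G[OF _ dom] by blast
  qed
  moreover have "(admissible_metric lam \<alpha> x \<Theta>, admissible_form lam \<alpha> x) \<in> conical_class lam \<alpha> x \<kappa>"
    using profile by (auto simp: conical_class_def)
  ultimately show "\<exists>\<kappa>>0. \<exists>(g, \<omega>)\<in>conical_class lam \<alpha> x \<kappa>. extremal_kaehler S L z g \<omega>"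
    using \<kappa> by blast
qed

end
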